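(* Let $M\subset\mathbb{P}(T\mathbb{P}^2(\mathbb{C}))$ be a (possibly singular) real submanifold of dimension three and regularity $\mathcal{C}^2$. Suppose that $N:=p(M)$ is a (possibly singular) real submanifold of $\mathbb{P}^2(\mathbb{C})$, and that $M$ and $N$ admit stratifications $M=\bigcup_i M_i$ and $N=\bigcup_i N_i$ such that the strata of dimension $3$ of $M$ are semi-legendrian, and such that for all strata $N_i<N_j$ and every sequence of points $y_n\in N_j$ with $y_n\to y_\infty\in N_i$, the tangent spaces $T_{y_n}N_j$ converge and their limit contains $T_{y_\infty}N_i$. Suppose moreover that $p$ maps every stratum of $M$ into a stratum of $N$ and is a submersion in restriction to each stratum. Then $M\subset p^*(p(M))$, where $p^*(p(M))=p^*N:=\bigcup_i p^*N_i$.
   Context: Let $X=\mathbb{P}(T\mathbb{P}^2(\mathbb{C}))=\{(z,d): z\in\mathbb{P}^2(\mathbb{C}),\ d \text{ a complex projective line},\ z\in d\}$ and $p:X\to\mathbb{P}^2(\mathbb{C})$, $p(z,d)=z$. The contact structure on $X$ is the field of complex 2-planes $\mathcal{P}_{(z,d)}=\{v\in T_{(z,d)}X : dp(v)\in T_zd\}$ (in affine coordinates $(x,y)$ with $\lambda$ the slope of $d$, $\mathcal{P}=\ker(dy-\lambda\,dx)$). A real submanifold of $X$ of real dimension 2 or 3 and regularity $\mathcal{C}^1$ is semi-legendrian if its tangent space $T_w$ satisfies $\dim_{\mathbb{R}}(\mathcal{P}_w\cap T_w)\ge 2$ at every smooth point $w$. If $N'\subset\mathbb{P}^2(\mathbb{C})$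 is a smooth real submanifold of dimension $\le 3$ and regularity $\mathcal{C}^1$, its lift is $p^*N'=\{(z,d)\in X: z\in N',\ T_zd+T_zN'\ne T_z\mathbb{P}^2(\mathbb{C})\}$. Stratification: if $Y$ is a possibly singular submanifold of regularity $\mathcal{C}^\mu$ of a $\mathcal{C}^\infty$ manifold, a stratification of $Y$ is a disjoint decomposition $Y=\bigcup_i Y_i$ where each $Y_i$ (a stratum) is a smooth (nonsingular) $\mathcal{C}^\mu$ submanifold, such that every point of $Y$ has a neighbourhood meeting only finitely many strata, and such that for $i\neq j$, if $Y_i\cap\overline{Y_j}\neq\emptyset$ then $\dim Y_i<\dim Y_j$; in this case one writes $Y_i<Y_j$. *)

theory Defs
  imports "HOL-Analysis.Analysis"
begin

section \<open>Submanifolds of Euclidean spaces\<close>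

fun Ck_on :: "nat \<Rightarrow> ('a::euclidean_space \<Rightarrow> 'b::euclidean_space) \<Rightarrow> 'a set \<Rightarrow> bool" where
  "Ck_on 0 f U \<longleftrightarrow> continuous_on U f"
| "Ck_on (Suc k) f U \<longleftrightarrow> (\<forall>x\<in>U. f differentiable (at x)) \<and>
     (\<forall>v. Ck_on k (\<lambda>x. frechet_derivative f (at x) v) U)"

definition euclidean_submanifold :: "nat \<Rightarrow> nat \<Rightarrow> 'e::euclidean_space set \<Rightarrow> bool" where
  "euclidean_submanifold k m S \<longleftrightarrow>
     (\<forall>x\<in>S. \<exists>U V F G W. open U \<and> x \<in> U \<and> open V \<and> homeomorphism U V F G \<and>
        Ck_on k F U \<and> Ck_on k G V \<and> subspace W \<and> dim W = m \<and> F ` (S \<inter> U) = V \<inter> (W :: 'e set))"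

text \<open>Convergence in the Grassmannian: the orthogonal projections onto the \<open>T n\<close> converge to the
  orthogonal projection onto \<open>L\<close>. (On a linear subspace, \<^const>\<open>closest_point\<close> is the orthogonal
  projection; in finite dimension pointwise convergence of linear maps is norm convergence.)\<close>

definition subspaces_tendsto :: "(nat \<Rightarrow> 'e::euclidean_space set) \<Rightarrow> 'e set \<Rightarrow> bool" where
  "subspaces_tendsto T L \<longleftrightarrow> subspace L \<and>
     (\<forall>v. (\<lambda>n. closest_point (T n) v) \<longlonglongrightarrow> closest_point L v)"

section \<open>Submanifolds of manifolds\<close>

text \<open>A manifold is given by an atlas of injective parametrizations \<open>\<phi>\<close>, each defined on a whole
  Euclidean space (this suffices for the two manifolds below) and having an open image; the charts
  are the maps \<open>inv \<phi>\<close>. A notion that is expressed in a chart around a point but does not depend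
  on that chart is required below in all charts of the atlas around the point.\<close>

definition submanifold :: "('e::euclidean_space \<Rightarrow> 'm) set \<Rightarrow> nat \<Rightarrow> nat \<Rightarrow> 'm set \<Rightarrow> bool" where
  "submanifold \<A> k m N \<longleftrightarrow> (\<forall>\<phi>\<in>\<A>. euclidean_submanifold k m (\<phi> -` N))"

definition smooth_points ::
    "('e::euclidean_space \<Rightarrow> 'm::topological_space) set \<Rightarrow> nat \<Rightarrow> nat \<Rightarrow> 'm set \<Rightarrow> 'm set" where
  "smooth_points \<A> k m N = {z \<in> N. \<exists>U. open U \<and> z \<in> U \<and> submanifold \<A> k m (N \<inter> U)}"

text \<open>Possibly singular submanifolds: the smooth points are dense. In the version with a dimension
  \<open>m\<close>, the smooth points of dimension \<open>m\<close> are dense, so that no piece of lower dimension is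
  attached.\<close>

definition singular_submanifold ::
    "('e::euclidean_space \<Rightarrow> 'm::topological_space) set \<Rightarrow> nat \<Rightarrow> 'm set \<Rightarrow> bool" where
  "singular_submanifold \<A> k N \<longleftrightarrow> N \<subseteq> closure (\<Union>m. smooth_points \<A> k m N)"

definition singular_submanifold_dim ::
    "('e::euclidean_space \<Rightarrow> 'm::topological_space) set \<Rightarrow> nat \<Rightarrow> nat \<Rightarrow> 'm set \<Rightarrow> bool" where
  "singular_submanifold_dim \<A> k m N \<longleftrightarrow> N \<subseteq> closure (smooth_points \<A> k m N)"

text \<open>The tangent space of \<open>N\<close> at \<open>z\<close>, read in the chart \<open>inv \<phi>\<close>: the velocities of the curves
  lying in \<open>N\<close>.\<close>

definition tangent :: "('e::euclidean_space \<Rightarrow> 'm) \<Rightarrow> 'm set \<Rightarrow> 'm \<Rightarrow> 'e set" where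
  "tangent \<phi> N z = {v. \<exists>\<gamma> :: real \<Rightarrow> 'e. (\<gamma> has_vector_derivative v) (at 0) \<and> \<phi> (\<gamma> 0) = z \<and>
     (\<forall>\<^sub>F t in nhds 0. \<phi> (\<gamma> t) \<in> N)}"

definition tangent_map ::
    "('e::euclidean_space \<Rightarrow> 'm) \<Rightarrow> ('f::euclidean_space \<Rightarrow> 'n) \<Rightarrow> ('m \<Rightarrow> 'n) \<Rightarrow> 'm \<Rightarrow> 'e \<Rightarrow> 'f" where
  "tangent_map \<phi> \<psi> f w = frechet_derivative (inv \<psi> \<circ> f \<circ> \<phi>) (at (inv \<phi> w))"

section \<open>Stratifications\<close>

definition stratum_less :: "('i \<Rightarrow> 'm::topological_space set) \<Rightarrow> 'i \<Rightarrow> 'i \<Rightarrow> bool" where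
  "stratum_less Y i j \<longleftrightarrow> i \<noteq> j \<and> Y i \<inter> closure (Y j) \<noteq> {}"

text \<open>\<open>d i\<close> is the dimension of the stratum \<open>Y i\<close>.\<close>

definition stratification ::
    "('e::euclidean_space \<Rightarrow> 'm::topological_space) set \<Rightarrow> nat \<Rightarrow>
     'i set \<Rightarrow> ('i \<Rightarrow> 'm set) \<Rightarrow> ('i \<Rightarrow> nat) \<Rightarrow> 'm set \<Rightarrow> bool" where
  "stratification \<A> k I Y d S \<longleftrightarrow>
     (\<Union>i\<in>I. Y i) = S \<and> disjoint_family_on Y I \<and>
     (\<forall>i\<in>I. submanifold \<A> k (d i) (Y i)) \<and>
     (\<forall>y\<in>S. \<exists>U. open U \<and> y \<in> U \<and> finite {i \<in> I. Y i \<inter> U \<noteq> {}}) \<and>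
     (\<forall>i\<in>I. \<forall>j\<in>I. stratum_less Y i j \<longrightarrow> d i < d j)"

section \<open>The complex projective plane\<close>

text \<open>Points are the complex lines through the origin of \<open>\<complex>\<^sup>3\<close>; \<open>vec.\<close> refers to the complex linear
  structure.\<close>

typedef cp2 = "{L :: (complex ^ 3) set. vec.subspace L \<and> vec.dim L = 1}"
proof -
  have "vec.dim (vec.span {axis 1 1 :: complex ^ 3}) = 1"
    by (simp add: vec.dim_span vec.dim_singleton axis_eq_0_iff)
  then show ?thesis
    by (intro exI[of _ "vec.span {axis 1 1}"]) (simp add: vec.subspace_span)
qed

definition homog :: "complex ^ 3 \<Rightarrow> cp2" where
  "homog v = Abs_cp2 (vec.span {v})"

definition projectivize :: "(complex ^ 3) set \<Rightarrow> cp2 set" where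
  "projectivize H = {z. Rep_cp2 z \<subseteq> H}"

definition projective_line :: "cp2 set \<Rightarrow> bool" where
  "projective_line d \<longleftrightarrow> (\<exists>H. vec.subspace H \<and> vec.dim H = 2 \<and> d = projectivize H)"

text \<open>Affine coordinates \<open>(x, y)\<close>, in the projective frame given by the columns of an invertible
  matrix \<open>A\<close>.\<close>

definition aff :: "complex ^ 3 ^ 3 \<Rightarrow> complex \<times> complex \<Rightarrow> cp2" where
  "aff A = (\<lambda>(x, y). homog (A *v vector [1, x, y]))"

definition cp2_atlas :: "(complex \<times> complex \<Rightarrow> cp2) set" where
  "cp2_atlas = {aff A | A. invertible A}"

instantiation cp2 :: topological_space
begin

definition open_cp2 :: "cp2 set \<Rightarrow> bool" where
  "open_cp2 U \<longleftrightarrow> (\<forall>\<phi>\<in>cp2_atlas. open (\<phi> -` U))"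

instance
  by standard (auto simp: open_cp2_def vimage_Int vimage_Union)

end

section \<open>The projectivized tangent bundle and its contact structure\<close>

typedef flag = "{(z, d). projective_line d \<and> z \<in> d}"
proof -
  let ?H = "vec.span {axis 1 1 :: complex ^ 3, axis 2 1}"
  have ne: "axis 1 1 \<noteq> (axis 2 1 :: complex ^ 3)"
    by (simp add: axis_eq_axis)
  have "vec.independent {axis 1 1 :: complex ^ 3, axis 2 1}"
    by (rule vec.independent_mono[OF independent_cart_basis]) (auto simp: cart_basis_def)
  then have "vec.dim ?H = 2"
    using ne by (simp add: vec.dim_span vec.dim_eq_card_independent)
  then have line: "projective_line (projectivize ?H)"
    unfolding projective_line_def using vec.subspace_span by blast
  have "vec.dim (vec.span {axis 1 1 :: complex ^ 3}) = 1"
    by (simp add: vec.dim_span vec.dim_singleton axis_eq_0_iff)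
  then have "Rep_cp2 (homog (axis 1 1)) = vec.span {axis 1 1}"
    unfolding homog_def by (intro Abs_cp2_inverse) (simp add: vec.subspace_span)
  then have "homog (axis 1 1) \<in> projectivize ?H"
    by (simp add: projectivize_def vec.span_mono)
  with line show ?thesis by blast
qed

text \<open>The map \<open>p\<close>, and the line \<open>d\<close> of a flag \<open>(z, d)\<close>.\<close>

definition pt :: "flag \<Rightarrow> cp2" where
  "pt w = fst (Rep_flag w)"

definition ln_of :: "flag \<Rightarrow> cp2 set" where
  "ln_of w = snd (Rep_flag w)"

text \<open>Affine coordinates \<open>(x, y, l)\<close>: the line through the point \<open>(x, y)\<close> with slope \<open>l\<close> is spanned
  by that point and the point at infinity with homogeneous coordinates \<open>(0, 1, l)\<close>.\<close>

definition slope_line :: "complex ^ 3 ^ 3 \<Rightarrow> complex \<times> complex \<times> complex \<Rightarrow> cp2 set" where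
  "slope_line A = (\<lambda>(x, y, l).
     projectivize (vec.span {A *v vector [1, x, y], A *v vector [0, 1, l]}))"

definition flag_aff :: "complex ^ 3 ^ 3 \<Rightarrow> complex \<times> complex \<times> complex \<Rightarrow> flag" where
  "flag_aff A = (\<lambda>(x, y, l). Abs_flag (aff A (x, y), slope_line A (x, y, l)))"

definition flag_atlas :: "(complex \<times> complex \<times> complex \<Rightarrow> flag) set" where
  "flag_atlas = {flag_aff A | A. invertible A}"

instantiation flag :: topological_space
begin

definition open_flag :: "flag set \<Rightarrow> bool" where
  "open_flag U \<longleftrightarrow> (\<forall>\<phi>\<in>flag_atlas. open (\<phi> -` U))"

instance
  by standard (auto simp: open_flag_def vimage_Int vimage_Union)

end

text \<open>\<open>dp A w\<close> is the derivative of \<open>p\<close> at \<open>w\<close>, and \<open>contact A w\<close> the contact plane at \<open>w\<close>, both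
  read in the affine coordinates given by \<open>A\<close>, for \<open>w\<close> in their range.\<close>

definition dp :: "complex ^ 3 ^ 3 \<Rightarrow> flag \<Rightarrow> complex \<times> complex \<times> complex \<Rightarrow> complex \<times> complex" where
  "dp A w = tangent_map (flag_aff A) (aff A) pt w"

definition contact :: "complex ^ 3 ^ 3 \<Rightarrow> flag \<Rightarrow> (complex \<times> complex \<times> complex) set" where
  "contact A w = {v \<in> tangent (flag_aff A) UNIV w. dp A w v \<in> tangent (aff A) (ln_of w) (pt w)}"

definition semi_legendrian :: "nat \<Rightarrow> flag set \<Rightarrow> bool" where
  "semi_legendrian m M \<longleftrightarrow> (m = 2 \<or> m = 3) \<and> singular_submanifold_dim flag_atlas 1 m M \<and>
     (\<forall>A. invertible A \<longrightarrow> (\<forall>w \<in> smooth_points flag_atlas 1 m M \<inter> range (flag_aff A).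
        dim (contact A w \<inter> tangent (flag_aff A) M w) \<ge> 2))"

text \<open>\<open>p\<close> restricts to a submersion from \<open>M\<close> to \<open>N\<close>.\<close>

definition p_submersion :: "flag set \<Rightarrow> cp2 set \<Rightarrow> bool" where
  "p_submersion M N \<longleftrightarrow> pt ` M \<subseteq> N \<and>
     (\<forall>A. invertible A \<longrightarrow> (\<forall>w \<in> M \<inter> range (flag_aff A).
        dp A w ` tangent (flag_aff A) M w = tangent (aff A) N (pt w)))"

definition lift :: "cp2 set \<Rightarrow> flag set" where
  "lift N = {w. pt w \<in> N \<and>
     (\<forall>A. invertible A \<and> pt w \<in> range (aff A) \<longrightarrow>
        {u + v | u v. u \<in> tangent (aff A) (ln_of w) (pt w) \<and> v \<in> tangent (aff A) N (pt w)}
          \<noteq> tangent (aff A) UNIV (pt w))}"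

text \<open>Convergence of tangent spaces along a pair \<open>Y < Z\<close> of strata.\<close>

definition tangent_spaces_converge :: "cp2 set \<Rightarrow> cp2 set \<Rightarrow> bool" where
  "tangent_spaces_converge Y Z \<longleftrightarrow>
     (\<forall>y y'. (\<forall>n. y n \<in> Z) \<and> y' \<in> Y \<and> y \<longlonglongrightarrow> y' \<longrightarrow>
        (\<forall>A. invertible A \<and> y' \<in> range (aff A) \<longrightarrow>
           (\<exists>L. subspaces_tendsto (\<lambda>n. tangent (aff A) Z (y n)) L \<and> tangent (aff A) Y y' \<subseteq> L)))"

section \<open>The affine coordinates are coordinates\<close>

lemma matrix_kernel:
  fixes A :: "complex ^ 3 ^ 3"
  assumes "invertible A"
  shows "A *v v = A *v w \<longleftrightarrow> v = w"
  using assms by (metis invertible_def matrix_vector_mul_assoc matrix_vector_mul_lid)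

lemma Rep_homog:
  assumes "v \<noteq> 0"
  shows "Rep_cp2 (homog v) = vec.span {v}"
  unfolding homog_def using assms
  by (intro Abs_cp2_inverse) (simp add: vec.subspace_span vec.dim_span vec.dim_singleton)

lemma aff_vector_nonzero:
  fixes A :: "complex ^ 3 ^ 3"
  assumes "invertible A"
  shows "A *v vector [1, x, y] \<noteq> (0 :: complex ^ 3)"
proof
  assume "A *v vector [1, x, y] = 0"
  then have "vector [1, x, y] = (0 :: complex ^ 3)"
    using matrix_kernel[OF assms, of "vector [1, x, y]" 0] by simp
  then show False by (metis vector_3(1) zero_index zero_neq_one)
qed

lemma Rep_aff:
  fixes A :: "complex ^ 3 ^ 3"
  assumes "invertible A"
  shows "Rep_cp2 (aff A (x, y)) = vec.span {A *v vector [1, x, y]}"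
  by (simp add: aff_def Rep_homog aff_vector_nonzero assms)

lemma inj_aff:
  fixes A :: "complex ^ 3 ^ 3"
  assumes "invertible A"
  shows "inj (aff A)"
proof (rule injI)
  fix u v assume eq: "aff A u = aff A v"
  obtain x y x' y' where uv: "u = (x, y)" "v = (x', y')" by (cases u, cases v)
  have "A *v vector [1, x, y] \<in> vec.span {A *v vector [1, x', y']}"
    using eq uv Rep_aff[OF assms] by (metis singletonI vec.span_base)
  then obtain c where "A *v vector [1, x, y] = c *s (A *v vector [1, x', y'])"
    by (auto simp: vec.span_singleton)
  then have "vector [1, x, y] = c *s (vector [1, x', y'] :: complex ^ 3)"
    by (simp add: matrix_kernel[OF assms] flip: vector_scalar_commute)
  then have "1 = c * 1 \<and> x = c * x' \<and> y = c * y'"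
    by (metis vector_3 vector_smult_component)
  then show "u = v" by (simp add: uv)
qed

lemma slope_vectors_independent:
  fixes A :: "complex ^ 3 ^ 3"
  assumes "invertible A"
  shows "A *v vector [1, x, y] \<noteq> A *v vector [0, 1, l :: complex]"
    and "vec.independent {A *v vector [1, x, y], A *v vector [0, 1, l]}"
proof -
  show ne: "A *v vector [1, x, y] \<noteq> A *v vector [0, 1, l :: complex]"
    using matrix_kernel[OF assms] by (metis vector_3(1) zero_neq_one)
  have 0: "A *v vector [0, 1, l] \<noteq> (0 :: complex ^ 3)"
    using matrix_kernel[OF assms, of "vector [0, 1, l]" 0]
    by (metis vector_3(2) zero_index zero_neq_one matrix_vector_mult_0_right)
  have "A *v vector [1, x, y] \<notin> vec.span {A *v vector [0, 1, l]}"
  proof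
    assume "A *v vector [1, x, y] \<in> vec.span {A *v vector [0, 1, l]}"
    then obtain c where "A *v vector [1, x, y] = c *s (A *v vector [0, 1, l])"
      by (auto simp: vec.span_singleton)
    then have "vector [1, x, y] = c *s (vector [0, 1, l] :: complex ^ 3)"
      by (simp add: matrix_kernel[OF assms] flip: vector_scalar_commute)
    then have "1 = c * 0" by (metis vector_3(1) vector_smult_component)
    then show False by simp
  qed
  with 0 show "vec.independent {A *v vector [1, x, y], A *v vector [0, 1, l]}"
    by (simp add: vec.independent_insert)
qed

lemma Rep_flag_aff:
  fixes A :: "complex ^ 3 ^ 3"
  assumes "invertible A"
  shows "Rep_flag (flag_aff A (x, y, l)) = (aff A (x, y), slope_line A (x, y, l))"
proof -
  let ?H = "vec.span {A *v vector [1, x, y], A *v vector [0, 1, l]}"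
  have "vec.dim ?H = 2"
    using slope_vectors_independent[OF assms, of x y l]
    by (simp add: vec.dim_span vec.dim_eq_card_independent)
  then have "projective_line (slope_line A (x, y, l))"
    unfolding projective_line_def slope_line_def using vec.subspace_span by auto
  moreover have "aff A (x, y) \<in> slope_line A (x, y, l)"
    by (simp add: slope_line_def projectivize_def Rep_aff assms vec.span_mono)
  ultimately show ?thesis
    by (simp add: flag_aff_def Abs_flag_inverse)
qed

lemma pt_flag_aff:
  fixes A :: "complex ^ 3 ^ 3"
  assumes "invertible A"
  shows "pt (flag_aff A (x, y, l)) = aff A (x, y)"
  by (simp add: pt_def Rep_flag_aff assms)

lemma flag_aff_covers: "\<exists>A. invertible A \<and> w \<in> range (flag_aff A)"
proof -
  obtain z d where w: "Rep_flag w = (z, d)" "projective_line d" "z \<in> d"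
    using Rep_flag[of w] by auto
  obtain H where H: "vec.subspace H" "vec.dim H = 2" "d = projectivize H"
    using w(2) projective_line_def by auto
  have L: "vec.subspace (Rep_cp2 z)" "vec.dim (Rep_cp2 z) = 1" "Rep_cp2 z \<subseteq> H"
    using Rep_cp2[of z] w(3) H(3) by (auto simp: projectivize_def)
  obtain B where B: "B \<subseteq> Rep_cp2 z" "vec.independent B" "Rep_cp2 z \<subseteq> vec.span B" "card B = 1"
    using vec.basis_exists[of "Rep_cp2 z"] L(2) by metis
  obtain a where a: "B = {a}" using B(4) card_1_singletonE by blast
  have za: "Rep_cp2 z = vec.span {a}"
    using B L(1) a by (metis vec.span_minimal subset_antisym)
  obtain C where C: "B \<subseteq> C" "C \<subseteq> H" "vec.independent C" "H \<subseteq> vec.span C"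
    using vec.maximal_independent_subset_extend[of B H] B L(3) by blast
  have "card C = 2" using C H(2) vec.dim_unique by metis
  then obtain b where b: "C = {a, b}" "a \<noteq> b"
    using C(1) a by (auto simp: card_2_iff)
  have Hab: "H = vec.span {a, b}"
    using C H(1) b by (metis vec.span_minimal subset_antisym)
  obtain D where D: "C \<subseteq> D" "vec.independent D" "UNIV \<subseteq> vec.span D"
    using vec.maximal_independent_subset_extend[OF subset_UNIV C(3)] by metis
  have "card D = vec.dim (UNIV :: (complex ^ 3) set)"
    using D by (intro vec.basis_card_eq_dim) auto
  then have "card D = 3"
    by (simp only: vec_dim_card) simp
  then have "card (D - {a, b}) = 1"
    using D(1) b by (simp add: card_Diff_subset)
  then obtain c where c: "D - {a, b} = {c}" using card_1_singletonE by blast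
  then have Dabc: "D = {a, b, c}" "c \<noteq> a" "c \<noteq> b" using D(1) b by auto
  define A :: "complex ^ 3 ^ 3" where "A = transpose (vector [a, b, c])"
  have mult: "A *v vector [r, s, t] = r *s a + s *s b + t *s c" for r s t
    by (simp add: A_def vec_eq_iff matrix_vector_mult_def transpose_def sum_3 mult.commute)
  have "columns A = {a, b, c}"
    unfolding columns_def column_def A_def transpose_def
    by (auto simp: UNIV_3 vec_eq_iff intro: exI[of _ 1] exI[of _ 2] exI[of _ 3])
  then have "vec.span (columns A) = UNIV" using D(3) Dabc by auto
  then have inv: "invertible A"
    using matrix_right_invertible_span_columns invertible_right_inverse by (metis)
  have "Rep_flag (flag_aff A (0, 0, 0)) = Rep_flag w"
    by (simp add: Rep_flag_aff[OF inv] w slope_line_def mult H(3) Hab Rep_aff[OF inv] za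
        flip: Rep_cp2_inject)
  then have "w = flag_aff A (0, 0, 0)" by (simp add: Rep_flag_inject)
  with inv show ?thesis by blast
qed

lemma inj_flag_aff:
  fixes A :: "complex ^ 3 ^ 3"
  assumes "invertible A"
  shows "inj (flag_aff A)"
proof (rule injI)
  fix u v assume eq: "flag_aff A u = flag_aff A v"
  obtain x y l x' y' l' where uv: "u = (x, y, l)" "v = (x', y', l')"
    by (cases u, cases v) auto
  have "(aff A (x, y), slope_line A (x, y, l)) = (aff A (x', y'), slope_line A (x', y', l'))"
    using eq unfolding uv by (metis Rep_flag_aff[OF assms])
  then have xy: "x' = x" "y' = y" and s: "slope_line A (x, y, l) = slope_line A (x, y, l')"
    using inj_aff[OF assms] by (auto simp: inj_def)
  have R: "Rep_cp2 (homog (A *v vector [0, 1, l])) = vec.span {A *v vector [0, 1, l]}"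
    using slope_vectors_independent(2)[OF assms, of x y l]
    by (intro Rep_homog) (auto simp: vec.dependent_zero)
  then have "homog (A *v vector [0, 1, l]) \<in> slope_line A (x, y, l)"
    by (simp add: slope_line_def projectivize_def vec.span_mono)
  then have "homog (A *v vector [0, 1, l]) \<in> slope_line A (x, y, l')"
    by (simp only: s)
  then have "vec.span {A *v vector [0, 1, l]} \<subseteq>
      vec.span {A *v vector [1, x, y], A *v vector [0, 1, l']}"
    by (simp add: slope_line_def projectivize_def R)
  then have "A *v vector [0, 1, l] \<in> vec.span {A *v vector [1, x, y], A *v vector [0, 1, l']}"
    using vec.span_base by blast
  then obtain c e where "A *v vector [0, 1, l] =
      c *s (A *v vector [1, x, y]) + e *s (A *v vector [0, 1, l'])"
    by (auto simp: vec.span_insert vec.span_singleton algebra_simps)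
  then have "vector [0, 1, l] = c *s vector [1, x, y] + e *s (vector [0, 1, l'] :: complex ^ 3)"
    by (simp add: matrix_kernel[OF assms] flip: vector_scalar_commute matrix_vector_right_distrib)
  then have "0 = c * 1 + e * 0 \<and> 1 = c * x + e * 1 \<and> l = c * y + e * l'"
    by (metis vector_3 vector_smult_component vector_add_component)
  then show "u = v" by (auto simp: uv xy)
qed

end

theory Submission
  imports Defs
begin

text \<open>
  Read in affine coordinates, the line \<open>d\<close> of slope \<open>l\<close> through a point \<open>z\<close> has as tangent space the
  kernel of the map \<open>defect l\<close>, \<open>(a, b) \<mapsto> b - l * a\<close>, onto \<open>\<complex>\<close>. Hence a real subspace \<open>T\<close> together
  with the tangent space of \<open>d\<close> fills the plane iff \<open>defect l\<close> maps \<open>T\<close> onto \<open>\<complex>\<close>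
  (\<open>spans_plane_iff_defect_onto\<close>), and the theorem says that \<open>defect l\<close> is never onto on the tangent
  space of the stratum of \<open>p(M)\<close> that contains \<open>z\<close>.

  On a stratum of \<open>M\<close> of dimension three this is a dimension count
  (\<open>semi_legendrian_tangent_projection\<close>). Its tangent space \<open>T\<close> has dimension three, and the contact
  plane is the kernel of \<open>defect l \<circ> dp\<close>, so that semi-legendrian means that \<open>defect l \<circ> dp\<close> has a
  kernel of dimension at least two on \<open>T\<close>. The image then has dimension at most one, and the
  submersion hypothesis identifies \<open>dp(T)\<close> with the tangent space of the stratum below.

  An arbitrary point of \<open>M\<close> is reached by a limit. First, the strata of dimension three are dense in \<open>M\<close>
  (\<open>maximal_stratum_dense\<close>): among the finitely many strata that meet a small neighbourhood of a
  smooth point, one of largest dimension avoids the closures of the others by the dimension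
  condition of a stratification, so it is open in \<open>M\<close> there and has the dimension of \<open>M\<close>. Hence every
  point \<open>w\<close> of \<open>M\<close> is the limit of points \<open>w n\<close> of one stratum of dimension three. Second, being onto
  \<open>\<complex>\<close> is an open condition on a subspace (\<open>defect_onto_open\<close>), and for it to pass from the tangent
  space at \<open>p(w)\<close> to those at \<open>p(w n)\<close> it suffices that each tangent vector at \<open>p(w)\<close> is a limit of
  tangent vectors at the \<open>p(w n)\<close>. This holds by the convergence hypothesis if \<open>p(w)\<close> lies in another
  stratum than the \<open>p(w n)\<close> (\<open>subspaces_tendsto_approx\<close>), and by \<open>C\<^sup>1\<close> regularity if it lies in the
  same one (\<open>tangent_lower_semicontinuous\<close>).

  The slope exists only in charts where \<open>d\<close> is not vertical. In the others, exchanging the two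
  coordinates makes \<open>d\<close> horizontal, and spanning the plane is invariant under the exchange
  (\<open>liftI\<close>).
\<close>

section \<open>Tangent spaces of submanifolds\<close>

lemma Ck_on_Suc_imp: "Ck_on (Suc k) f U \<Longrightarrow> Ck_on k f U"
proof (induction k arbitrary: f)
  case 0
  then show ?case
    by (auto simp: continuous_on_eq_continuous_at intro!: continuous_at_imp_continuous_on
        differentiable_imp_continuous_within)
next
  case (Suc k)
  then show ?case by (metis Ck_on.simps(2))
qed

lemma Ck_on_Suc_imp_C1: "Ck_on (Suc k) f U \<Longrightarrow> Ck_on (Suc 0) f U"
  by (induction k) (use Ck_on_Suc_imp in blast)+

lemma tangent_chart:
  assumes "inj \<phi>"
  shows "tangent \<phi> N (\<phi> x) = tangent id (\<phi> -` N) x"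
  unfolding tangent_def using assms by (simp add: inj_eq)

lemma tangent_mono_local:
  assumes "open O'" "x \<in> O'" "S \<inter> O' \<subseteq> T"
  shows "tangent id S x \<subseteq> tangent id T x"
proof
  fix v assume "v \<in> tangent id S x"
  then obtain g :: "real \<Rightarrow> 'a" where g: "(g has_vector_derivative v) (at 0)" "g 0 = x"
      "\<forall>\<^sub>F t in nhds 0. g t \<in> S"
    by (auto simp: tangent_def)
  have "isCont g 0" using g(1) has_vector_derivative_continuous by blast
  then have "\<forall>\<^sub>F t in nhds 0. g t \<in> O'"
    using assms(1,2) g(2) by (auto simp: continuous_at_open eventually_nhds)
  with g(3) have "\<forall>\<^sub>F t in nhds 0. g t \<in> T"
    by eventually_elim (use assms(3) in auto)
  with g show "v \<in> tangent id T x" by (auto simp: tangent_def)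
qed

lemma vector_derivative_in_subspace:
  fixes W :: "'e::euclidean_space set"
  assumes W: "subspace W" and f: "(f has_vector_derivative v) (at t)"
    and ev: "\<forall>\<^sub>F s in nhds t. f s \<in> W"
  shows "v \<in> W"
proof -
  \<comment> \<open>test against the orthogonal complement, whose double complement is \<open>W\<close>\<close>
  have "orthogonal w v" if w: "w \<in> W\<^sup>\<bottom>" for w
  proof -
    have "\<forall>\<^sub>F s in nhds t. s \<in> UNIV \<longrightarrow> w \<bullet> f s = 0"
      using ev by eventually_elim (use w in \<open>auto simp: orthogonal_comp_def orthogonal_def inner_commute\<close>)
    moreover have "w \<bullet> f t = 0"
      using eventually_nhds_x_imp_x[OF calculation] by simp
    moreover have "((\<lambda>s. w \<bullet> f s) has_vector_derivative w \<bullet> v) (at t)"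
      using bounded_linear.has_vector_derivative[OF bounded_linear_inner_right f] .
    ultimately have "((\<lambda>s. 0) has_vector_derivative w \<bullet> v) (at t)"
      using has_vector_derivative_cong_ev[of UNIV "\<lambda>s. w \<bullet> f s" "\<lambda>s. 0" t] by simp
    then have "w \<bullet> v = 0"
      using has_vector_derivative_const vector_derivative_unique_at by metis
    then show ?thesis by (simp add: orthogonal_def)
  qed
  then have "v \<in> W\<^sup>\<bottom>\<^sup>\<bottom>" by (auto simp: orthogonal_comp_def)
  then show ?thesis using orthogonal_comp_self[OF W] by simp
qed

text \<open>A straightening chart \<open>F\<close> turns curves in \<open>S\<close> into curves in \<open>W\<close>, and its inverse \<open>G\<close> turns the
  straight lines of \<open>W\<close> through \<open>F y\<close> back into curves in \<open>S\<close>.\<close>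

lemma tangent_subspace_chart:
  fixes F :: "'e::euclidean_space \<Rightarrow> 'e"
  assumes U: "open U" and V: "open V" and FG: "homeomorphism U V F G" and W: "subspace W"
    and FS: "F ` (S \<inter> U) = V \<inter> W" and y: "y \<in> S \<inter> U"
    and F': "(F has_derivative F') (at y)" and G': "(G has_derivative G') (at (F y))"
    and inv: "\<And>v. G' (F' v) = v"
  shows "tangent id S y = {v. F' v \<in> W}"
proof (intro set_eqI iffI)
  fix v assume "v \<in> tangent id S y"
  then obtain g where g: "(g has_vector_derivative v) (at 0)" "g 0 = y"
      "\<forall>\<^sub>F t in nhds (0::real). g t \<in> S"
    by (auto simp: tangent_def)
  have "isCont g 0" using g(1) has_vector_derivative_continuous by blast
  then have "\<forall>\<^sub>F t in nhds 0. g t \<in> U"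
    using U y g(2) by (auto simp: continuous_at_open eventually_nhds)
  with g(3) have ev: "\<forall>\<^sub>F t in nhds 0. F (g t) \<in> W"
    by eventually_elim (use FS in blast)
  have "(F has_derivative F') (at (g 0))" using F' g(2) by simp
  then have "((F \<circ> g) has_vector_derivative F' v) (at 0)"
    using vector_derivative_diff_chain_within[OF g(1), of F F' ] has_derivative_at_withinI by blast
  then show "v \<in> {v. F' v \<in> W}"
    using vector_derivative_in_subspace[OF W] ev by (simp add: o_def)
next
  fix v assume "v \<in> {v. F' v \<in> W}"
  then have v: "F' v \<in> W" by simp
  let ?g = "\<lambda>t::real. G (F y + t *\<^sub>R F' v)"
  have Fy: "F y \<in> V \<inter> W" using FS y by blast
  have "(G has_derivative G') (at ((\<lambda>t::real. F y + t *\<^sub>R F' v) 0))" using G' by simp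
  moreover have "((\<lambda>t::real. F y + t *\<^sub>R F' v) has_vector_derivative F' v) (at 0)"
    by (auto intro!: derivative_eq_intros)
  ultimately have "((G \<circ> (\<lambda>t::real. F y + t *\<^sub>R F' v)) has_vector_derivative G' (F' v)) (at 0)"
    using vector_derivative_diff_chain_within has_derivative_at_withinI by blast
  then have der: "(?g has_vector_derivative v) (at 0)" by (simp add: inv o_def)
  have "isCont (\<lambda>t::real. F y + t *\<^sub>R F' v) 0" by simp
  then have "\<forall>\<^sub>F t in nhds (0::real). F y + t *\<^sub>R F' v \<in> V"
    using V Fy unfolding continuous_at_open eventually_nhds
    by (metis IntD1 add.right_neutral scale_zero_left)
  then have "\<forall>\<^sub>F t in nhds 0. ?g t \<in> S"
  proof eventually_elim
    case (elim t)
    then have "F y + t *\<^sub>R F' v \<in> V \<inter> W"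
      using Fy v W by (auto intro: subspace_add subspace_scale)
    then obtain s where "s \<in> S \<inter> U" "F y + t *\<^sub>R F' v = F s" using FS by force
    then show ?case using FG by (auto simp: homeomorphism_def)
  qed
  moreover have "?g 0 = y" using FG y by (auto simp: homeomorphism_def)
  ultimately show "v \<in> tangent id S y" using der by (auto simp: tangent_def)
qed

text \<open>Here \<open>D y\<close> is the derivative at \<open>y\<close> of a straightening chart and \<open>E y\<close> its inverse, the
  derivative of the inverse chart. What matters is that they are defined at all points near \<open>x\<close>, with
  the same model space \<open>W\<close>, and that \<open>E\<close> is continuous in \<open>y\<close>.\<close>

lemma submanifold_frame:
  fixes S :: "'e::euclidean_space set"
  assumes "euclidean_submanifold (Suc k) m S" "x \<in> S"
  obtains U W and D E :: "'e \<Rightarrow> 'e \<Rightarrow> 'e" where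
    "open U" "x \<in> U" "subspace W" "dim W = m"
    "\<And>y. y \<in> U \<Longrightarrow> linear (D y)"
    "\<And>y v. y \<in> U \<Longrightarrow> D y (E y v) = v" "\<And>y v. y \<in> U \<Longrightarrow> E y (D y v) = v"
    "\<And>y. y \<in> S \<inter> U \<Longrightarrow> tangent id S y = {v. D y v \<in> W}"
    "\<And>c. continuous_on U (\<lambda>y. E y c)"
proof -
  obtain U V F G W where U: "open U" "x \<in> U" "open V" "homeomorphism U V F G"
      and C: "Ck_on (Suc k) F U" "Ck_on (Suc k) G V"
      and W: "subspace W" "dim W = m" "F ` (S \<inter> U) = V \<inter> (W :: 'e set)"
    using assms unfolding euclidean_submanifold_def by meson
  define D where "D y = frechet_derivative F (at y)" for y
  define E where "E y = frechet_derivative G (at (F y))" for y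
  have FV: "F y \<in> V" "G (F y) = y" if "y \<in> U" for y
    using U(4) that by (auto simp: homeomorphism_def)
  have D: "(F has_derivative D y) (at y)" if "y \<in> U" for y
    using C(1) that by (simp add: D_def flip: frechet_derivative_works)
  have E: "(G has_derivative E y) (at (F y))" if "y \<in> U" for y
    using C(2) FV(1)[OF that] by (simp add: E_def flip: frechet_derivative_works)
  have ED: "E y (D y v) = v" if y: "y \<in> U" for y v
  proof -
    have "((G \<circ> F) has_derivative E y \<circ> D y) (at y)"
      using diff_chain_at[OF D[OF y] E[OF y]] .
    then have "((\<lambda>z. z) has_derivative E y \<circ> D y) (at y)"
      by (rule has_derivative_transform_within_open[OF _ U(1) y]) (simp add: FV)
    then have "E y \<circ> D y = (\<lambda>z. z)"
      using has_derivative_unique has_derivative_ident by blast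
    then show ?thesis by (metis comp_apply)
  qed
  have DE: "D y (E y v) = v" if y: "y \<in> U" for y v
  proof -
    have G: "G (F y) \<in> U" "(F has_derivative D y) (at (G (F y)))" using D FV y by auto
    have "((F \<circ> G) has_derivative D y \<circ> E y) (at (F y))"
      using diff_chain_at[OF E[OF y] G(2)] .
    then have "((\<lambda>z. z) has_derivative D y \<circ> E y) (at (F y))"
      by (rule has_derivative_transform_within_open[OF _ U(3) FV(1)[OF y]])
        (use U(4) in \<open>auto simp: homeomorphism_def\<close>)
    then have "D y \<circ> E y = (\<lambda>z. z)"
      using has_derivative_unique has_derivative_ident by blast
    then show ?thesis by (metis comp_apply)
  qed
  have cont: "continuous_on U (\<lambda>y. E y c)" for c
  proof -
    have "continuous_on V (\<lambda>z. frechet_derivative G (at z) c)"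
      using Ck_on_Suc_imp_C1[OF C(2)] by simp
    then show ?thesis unfolding E_def
      by (rule continuous_on_compose2) (use U(4) in \<open>auto simp: homeomorphism_def\<close>)
  qed
  have tan: "tangent id S y = {v. D y v \<in> W}" if "y \<in> S \<inter> U" for y
    by (rule tangent_subspace_chart[OF U(1) U(3) U(4) W(1) W(3) that D E])
      (use that ED in auto)
  show ?thesis
  proof (rule that[of U W D E])
    show "linear (D y)" if "y \<in> U" for y
      using D[OF that] by (rule has_derivative_linear)
  qed (fact U W DE ED tan cont)+
qed

lemma tangent_submanifold:
  assumes "euclidean_submanifold (Suc k) m S" "x \<in> S"
  shows "subspace (tangent id S x)" and "dim (tangent id S x) = m"
proof -
  obtain U W and D E :: "'a \<Rightarrow> 'a \<Rightarrow> 'a" where *: "open U" "x \<in> U" "subspace W" "dim W = m"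
    "\<And>y. y \<in> U \<Longrightarrow> linear (D y)"
    "\<And>y v. y \<in> U \<Longrightarrow> D y (E y v) = v" "\<And>y v. y \<in> U \<Longrightarrow> E y (D y v) = v"
    "\<And>y. y \<in> S \<inter> U \<Longrightarrow> tangent id S y = {v. D y v \<in> W}"
    by (rule submanifold_frame[OF assms]) (rule that; assumption)
  have T: "tangent id S x = D x -` W" using *(8)[of x] *(2) assms(2) by auto
  show "subspace (tangent id S x)"
    unfolding T by (rule linear_subspace_vimage[OF *(5)[OF *(2)] *(3)])
  have "D x ` (D x -` W) = W"
    by (intro surj_image_vimage_eq surjI[of _ "E x"]) (rule *(6)[OF *(2)])
  moreover have "inj (D x)"
    by (rule inj_on_inverseI[of _ "E x"]) (rule *(7)[OF *(2)])
  then have "dim (D x ` (D x -` W)) = dim (D x -` W)"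
    by (intro dim_image_eq *(5)[OF *(2)]) (rule inj_on_subset, assumption, simp)
  ultimately show "dim (tangent id S x) = m"
    unfolding T using *(4) by simp
qed

text \<open>In a straightening chart \<open>v\<close> can be transported as a constant vector of the model space; it returns
  as \<open>E (X n) (D x v)\<close>.\<close>

lemma tangent_lower_semicontinuous:
  assumes "euclidean_submanifold (Suc k) m S" "x \<in> S" "\<And>n. X n \<in> S" "X \<longlonglongrightarrow> x"
    and "v \<in> tangent id S x"
  shows "\<exists>Z. (\<forall>\<^sub>F n in sequentially. Z n \<in> tangent id S (X n)) \<and> Z \<longlonglongrightarrow> v"
proof -
  obtain U W and D E :: "'a \<Rightarrow> 'a \<Rightarrow> 'a" where *: "open U" "x \<in> U" 
    "\<And>y v. y \<in> U \<Longrightarrow> D y (E y v) = v" "\<And>y v. y \<in> U \<Longrightarrow> E y (D y v) = v"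
    "\<And>y. y \<in> S \<inter> U \<Longrightarrow> tangent id S y = {v. D y v \<in> W}"
    "\<And>c. continuous_on U (\<lambda>y. E y c)"
    by (rule submanifold_frame[OF assms(1,2)]) (rule that; assumption)
  let ?Z = "\<lambda>n. E (X n) (D x v)"
  have "\<forall>\<^sub>F n in sequentially. X n \<in> U" using *(1,2) assms(4) topological_tendstoD by blast
  then have "\<forall>\<^sub>F n in sequentially. ?Z n \<in> tangent id S (X n)"
    by eventually_elim (use * assms in auto)
  moreover have "isCont (\<lambda>y. E y (D x v)) x"
    using *(1,2,6) continuous_on_eq_continuous_at by blast
  then have "?Z \<longlonglongrightarrow> E x (D x v)" using assms(4) isCont_tendsto_compose by blast
  ultimately show ?thesis using *(2,4) by metis
qed

lemma dimension_agrees_locally: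
  assumes "euclidean_submanifold (Suc k) m S" "euclidean_submanifold (Suc l) n T"
    "open O'" "x \<in> O'" "S \<inter> O' = T \<inter> O'" "x \<in> S"
  shows "m = n"
proof -
  have "tangent id S x = tangent id T x"
    using tangent_mono_local[OF assms(3,4)] assms(5) by (metis inf_le1 subset_antisym)
  then show ?thesis using tangent_submanifold(2) assms by (metis IntD1 IntI)
qed

text \<open>The approximating vectors are the projections of \<open>v\<close> onto the \<open>T n\<close>.\<close>

lemma subspaces_tendsto_approx:
  assumes "subspaces_tendsto T L" "\<And>n. subspace (T n)" "v \<in> L"
  shows "\<exists>Z. (\<forall>\<^sub>F n in sequentially. Z n \<in> T n) \<and> Z \<longlonglongrightarrow> v"
proof -
  have "closest_point (T n) v \<in> T n" for n
    using assms(2)[of n] closed_subspace subspace_0 by (intro closest_point_in_set) auto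
  moreover have "(\<lambda>n. closest_point (T n) v) \<longlonglongrightarrow> v"
    using assms(1,3) closest_point_self unfolding subspaces_tendsto_def by metis
  ultimately show ?thesis by (intro exI[of _ "\<lambda>n. closest_point (T n) v"]) simp
qed

section \<open>Strata of maximal dimension\<close>

text \<open>If \<open>w\<close> were outside the closures of the strata of dimension \<open>m\<close>, a smooth point of dimension \<open>m\<close>
  would have a neighbourhood disjoint from all of them. There a stratum of largest dimension is
  disjoint from the closures of the other strata, hence coincides locally with \<open>M\<close>, and the dimension of
  \<open>M\<close> can be read off from its tangent spaces.\<close>

lemma maximal_stratum_dense:
  fixes \<A> :: "('e::euclidean_space \<Rightarrow> 'm::topological_space) set"
  assumes cover: "\<And>z. \<exists>\<phi>\<in>\<A>. z \<in> range \<phi>"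
    and cont: "\<And>\<phi> U. \<phi> \<in> \<A> \<Longrightarrow> open U \<Longrightarrow> open (\<phi> -` U)"
    and M: "singular_submanifold_dim \<A> (Suc k) m M"
    and strat: "stratification \<A> (Suc k) I Y d M"
    and w: "w \<in> M"
  shows "\<exists>i\<in>I. d i = m \<and> w \<in> closure (Y i)"
proof (rule ccontr)
  assume contra: "\<not> (\<exists>i\<in>I. d i = m \<and> w \<in> closure (Y i))"
  have un: "(\<Union>i\<in>I. Y i) = M"
    and sub: "\<And>i. i \<in> I \<Longrightarrow> submanifold \<A> (Suc k) (d i) (Y i)"
    and less: "\<And>i j. i \<in> I \<Longrightarrow> j \<in> I \<Longrightarrow> stratum_less Y i j \<Longrightarrow> d i < d j"
    using strat by (auto simp: stratification_def)
  obtain U where U: "open U" "w \<in> U" "finite {i \<in> I. Y i \<inter> U \<noteq> {}}"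
    using strat w unfolding stratification_def by blast
  define O0 where "O0 = U - (\<Union>i\<in>{i \<in> I. Y i \<inter> U \<noteq> {} \<and> d i = m}. closure (Y i))"
  have "finite {i \<in> I. Y i \<inter> U \<noteq> {} \<and> d i = m}"
    by (rule finite_subset[OF _ U(3)]) auto
  then have O0: "open O0" "w \<in> O0"
    unfolding O0_def using U contra by (auto intro!: open_Diff closed_UN)
  have "w \<in> closure (smooth_points \<A> (Suc k) m M)"
    using M w by (auto simp: singular_submanifold_dim_def)
  then have "O0 \<inter> smooth_points \<A> (Suc k) m M \<noteq> {}"
    using open_Int_closure_eq_empty[OF O0(1)] O0(2) by blast
  then obtain x U' where x: "x \<in> O0" "x \<in> M" "open U'" "x \<in> U'"
      and U': "submanifold \<A> (Suc k) m (M \<inter> U')"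
    by (auto simp: smooth_points_def)
  define O1 where "O1 = O0 \<inter> U'"
  have O1: "open O1" "x \<in> O1" using O0 x by (auto simp: O1_def)
  define G where "G = {i \<in> I. Y i \<inter> O1 \<noteq> {}}"
  have "finite G"
    by (rule finite_subset[OF _ U(3)]) (auto simp: G_def O1_def O0_def)
  moreover have "G \<noteq> {}" using un x(2) O1(2) by (auto simp: G_def)
  ultimately have "Max (d ` G) \<in> d ` G" by (intro Max_in) auto
  then obtain i where i: "i \<in> G" "d i = Max (d ` G)" by auto
  have i_max: "d j \<le> d i" if "j \<in> G" for j
    unfolding i(2) using that \<open>finite G\<close> by (intro Max_ge) auto
  obtain y where y: "y \<in> Y i" "y \<in> O1" using i(1) by (auto simp: G_def)
  \<comment> \<open>in \<open>O2\<close> only the stratum \<open>i\<close> of largest dimension is left\<close>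
  define O2 where "O2 = O1 - (\<Union>j\<in>G - {i}. closure (Y j))"
  have "open O2"
    unfolding O2_def using O1(1) \<open>finite G\<close> by (auto intro!: open_Diff closed_UN)
  have "y \<notin> closure (Y j)" if "j \<in> G - {i}" for j
  proof
    assume "y \<in> closure (Y j)"
    then have "stratum_less Y i j" using y(1) that by (auto simp: stratum_less_def)
    then have "d i < d j" using less i(1) that by (auto simp: G_def)
    with i_max[of j] that show False by auto
  qed
  then have "y \<in> O2" using y(2) by (auto simp: O2_def)
  have eq: "M \<inter> U' \<inter> O2 = Y i \<inter> O2"
  proof
    show "M \<inter> U' \<inter> O2 \<subseteq> Y i \<inter> O2"
    proof
      fix z assume z: "z \<in> M \<inter> U' \<inter> O2"
      then obtain j where j: "j \<in> I" "z \<in> Y j" using un by blast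
      then have "j \<in> G" using z by (auto simp: G_def O2_def)
      then have "j = i" using z j(2) closure_subset by (fastforce simp: O2_def)
      with j z show "z \<in> Y i \<inter> O2" by simp
    qed
    show "Y i \<inter> O2 \<subseteq> M \<inter> U' \<inter> O2"
      using un i(1) by (auto simp: G_def O2_def O1_def)
  qed
  obtain \<phi> v where \<phi>: "\<phi> \<in> \<A>" "y = \<phi> v" using cover by blast
  have "d i = m"
  proof (rule dimension_agrees_locally)
    show "euclidean_submanifold (Suc k) (d i) (\<phi> -` Y i)"
      using sub i(1) \<phi>(1) by (auto simp: G_def submanifold_def)
    show "euclidean_submanifold (Suc k) m (\<phi> -` (M \<inter> U'))"
      using U' \<phi>(1) by (auto simp: submanifold_def)
    show "open (\<phi> -` O2)" using cont \<phi>(1) \<open>open O2\<close> .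
    show "\<phi> -` Y i \<inter> \<phi> -` O2 = \<phi> -` (M \<inter> U') \<inter> \<phi> -` O2"
      by (simp only: eq flip: vimage_Int)
    show "v \<in> \<phi> -` O2" "v \<in> \<phi> -` Y i" using \<phi>(2) \<open>y \<in> O2\<close> y(1) by auto
  qed
  moreover have "y \<in> U" "y \<in> O0" using y(2) by (auto simp: O1_def O0_def)
  ultimately show False
    using y(1) i(1) closure_subset by (fastforce simp: O0_def G_def)
qed

section \<open>Coordinates on the flag variety\<close>

lemma vec_span_pair_iff:
  "(v :: complex ^ 3) \<in> vec.span {a, b} \<longleftrightarrow> (\<exists>k m. v = k *s a + m *s b)"
proof
  assume "v \<in> vec.span {a, b}"
  then obtain k m where "v - k *s a = m *s b"
    by (auto simp: vec.span_insert vec.span_singleton)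
  then have "v = k *s a + m *s b" by (simp add: diff_eq_eq add.commute)
  then show "\<exists>k m. v = k *s a + m *s b" by blast
next
  assume "\<exists>k m. v = k *s a + m *s b"
  then show "v \<in> vec.span {a, b}"
    by (elim exE, simp only:) (intro vec.span_add vec.span_scale vec.span_base; simp)
qed

text \<open>Equality of flags in terms of frames. Only one inclusion of spans is needed on each level of the
  flag, as the dimensions agree.\<close>

lemma flag_aff_eq_iff:
  fixes A B :: "complex ^ 3 ^ 3"
  assumes A: "invertible A" and B: "invertible B"
  shows "flag_aff B (x, y, l) = flag_aff A (x', y', l') \<longleftrightarrow>
    (\<exists>c. B *v vector [1, x, y] = c *s (A *v vector [1, x', y'])) \<and>
    (\<exists>a e. B *v vector [0, 1, l] = a *s (A *v vector [1, x', y']) + e *s (A *v vector [0, 1, l']))"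
    (is "?L \<longleftrightarrow> ?P \<and> ?Q")
proof -
  let ?p = "B *v vector [1, x, y]" and ?q = "B *v vector [0, 1, l]"
  let ?u = "A *v vector [1, x', y']" and ?t = "A *v vector [0, 1, l']"
  have P: "?P \<longleftrightarrow> ?p \<in> vec.span {?u}" by (auto simp: vec.span_singleton)
  have Q: "?Q \<longleftrightarrow> ?q \<in> vec.span {?u, ?t}" by (simp add: vec_span_pair_iff)
  have L: "?L \<longleftrightarrow> vec.span {?p} = vec.span {?u} \<and>
      projectivize (vec.span {?p, ?q}) = projectivize (vec.span {?u, ?t})"
    by (auto simp: slope_line_def Rep_flag_aff A B Rep_aff simp flip: Rep_flag_inject Rep_cp2_inject)
  show ?thesis
  proof
    assume ?L
    then have *: "vec.span {?p} = vec.span {?u}"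
      "projectivize (vec.span {?p, ?q}) = projectivize (vec.span {?u, ?t})"
      using L by auto
    have "?q \<noteq> 0"
      using slope_vectors_independent(2)[OF B, of x y l] by (auto simp: vec.dependent_zero)
    then have R: "Rep_cp2 (homog ?q) = vec.span {?q}" by (rule Rep_homog)
    then have "homog ?q \<in> projectivize (vec.span {?p, ?q})"
      by (simp add: projectivize_def vec.span_mono)
    then have "vec.span {?q} \<subseteq> vec.span {?u, ?t}"
      unfolding * by (simp add: projectivize_def R)
    then have "?q \<in> vec.span {?u, ?t}" using vec.span_base by blast
    moreover have "?p \<in> vec.span {?u}" using *(1) vec.span_base by blast
    ultimately show "?P \<and> ?Q" using P Q by blast
  next
    assume PQ: "?P \<and> ?Q"
    then have p: "?p \<in> vec.span {?u}" and q: "?q \<in> vec.span {?u, ?t}" using P Q by auto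
    have "vec.span {?p} = vec.span {?u}"
      using p aff_vector_nonzero[OF B] aff_vector_nonzero[OF A]
      by (intro vec.subspace_dim_equal vec.span_minimal)
        (auto simp: vec.subspace_span vec.dim_span vec.dim_singleton)
    moreover have "?p \<in> vec.span {?u, ?t}"
      using p vec.span_mono[of "{?u}" "{?u, ?t}"] by auto
    then have "vec.span {?p, ?q} = vec.span {?u, ?t}"
      using q slope_vectors_independent[OF A, of x' y' l'] slope_vectors_independent[OF B, of x y l]
      by (intro vec.subspace_dim_equal vec.span_minimal)
        (auto simp: vec.subspace_span vec.dim_span vec.dim_eq_card_independent)
    ultimately show ?L using L by simp
  qed
qed

lemma matrix_vector_3:
  "(C :: complex ^ 3 ^ 3) *v vector [a, b, c] = vector [C$1$1 * a + C$1$2 * b + C$1$3 * c,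
     C$2$1 * a + C$2$2 * b + C$2$3 * c, C$3$1 * a + C$3$2 * b + C$3$3 * c]"
  by (simp add: vec_eq_iff forall_3 matrix_vector_mult_def sum_3)

text \<open>The change of coordinates from \<open>B\<close> to \<open>A\<close>. In the frame \<open>A\<close> the point is spanned by the vector
  \<open>(q 1, q 2, q 3)\<close>, and the line also contains \<open>(0, s 2, s 3)\<close>, obtained by eliminating the first
  coordinate of the second spanning vector; normalizing both gives the new coordinates. The flag lies in
  the domain of the frame \<open>A\<close> exactly when both normalizations are possible.\<close>

lemma flag_aff_transition:
  fixes A B :: "complex ^ 3 ^ 3"
  assumes A: "invertible A" and B: "invertible B" and BC: "B = A ** C"
    and q_def: "\<And>i x y. q i x y = C$i$1 + C$i$2 * x + C$i$3 * y"
    and r_def: "\<And>i l. r i l = C$i$2 + C$i$3 * l"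
    and s_def: "\<And>i x y l. s i x y l = q 1 x y * r i l - r 1 l * q i x y"
  shows "flag_aff B (x, y, l) = flag_aff A (x', y', l') \<longleftrightarrow> q 1 x y \<noteq> 0 \<and> s 2 x y l \<noteq> 0 \<and>
    (x', y', l') = (q 2 x y / q 1 x y, q 3 x y / q 1 x y, s 3 x y l / s 2 x y l)"
proof -
  obtain A' where A': "A ** A' = mat 1" "A' ** A = mat 1"
    using A unfolding invertible_def by blast
  have "C = A' ** B" by (simp add: BC A' matrix_mul_assoc)
  moreover have "invertible A'" using A' unfolding invertible_def by blast
  ultimately have C: "invertible C" using B by (simp add: invertible_mult)
  have eq: "flag_aff B (x, y, l) = flag_aff A (x', y', l') \<longleftrightarrow>
    (\<exists>c. C *v vector [1, x, y] = c *s vector [1, x', y']) \<and>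
    (\<exists>a e. C *v vector [0, 1, l] = a *s vector [1, x', y'] + e *s vector [0, 1, l'])"
    unfolding flag_aff_eq_iff[OF A B] unfolding BC
    by (simp add: matrix_kernel[OF A]
        flip: matrix_vector_mul_assoc vector_scalar_commute matrix_vector_right_distrib)
  have q: "(\<exists>c. C *v vector [1, x, y] = c *s vector [1, x', y']) \<longleftrightarrow>
      q 2 x y = q 1 x y * x' \<and> q 3 x y = q 1 x y * y'"
    by (auto simp: matrix_vector_3 vec_eq_iff forall_3 q_def)
  have r: "(\<exists>a e. C *v vector [0, 1, l] = a *s vector [1, x', y'] + e *s vector [0, 1, l']) \<longleftrightarrow>
      (\<exists>e. r 2 l = r 1 l * x' + e \<and> r 3 l = r 1 l * y' + e * l')"
    by (auto simp: matrix_vector_3 vec_eq_iff forall_3 r_def)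
  show ?thesis
  proof
    assume "flag_aff B (x, y, l) = flag_aff A (x', y', l')"
    then obtain e where e: "q 2 x y = q 1 x y * x'" "q 3 x y = q 1 x y * y'"
        "r 2 l = r 1 l * x' + e" "r 3 l = r 1 l * y' + e * l'"
      using eq q r by auto
    have q0: "q 1 x y \<noteq> 0"
    proof
      assume "q 1 x y = 0"
      then have "C *v vector [1, x, y] = 0"
        using e by (simp add: matrix_vector_3 vec_eq_iff forall_3 q_def)
      then show False using aff_vector_nonzero[OF C] by blast
    qed
    have e0: "e \<noteq> 0"
    proof
      assume "e = 0"
      then have "C *v vector [0, 1, l] = (r 1 l / q 1 x y) *s (C *v vector [1, x, y])"
        using e q0 by (simp add: matrix_vector_3 vec_eq_iff forall_3 flip: q_def r_def)
      then have "vector [0, 1, l] = (r 1 l / q 1 x y) *s (vector [1, x, y] :: complex ^ 3)"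
        by (simp add: matrix_kernel[OF C] flip: vector_scalar_commute)
      then show False by (auto simp: vec_eq_iff forall_3)
    qed
    have s: "s 2 x y l = q 1 x y * e" "s 3 x y l = q 1 x y * e * l'"
      using e by (auto simp: s_def algebra_simps)
    show "q 1 x y \<noteq> 0 \<and> s 2 x y l \<noteq> 0 \<and>
      (x', y', l') = (q 2 x y / q 1 x y, q 3 x y / q 1 x y, s 3 x y l / s 2 x y l)"
      using q0 e0 s e by auto
  next
    assume *: "q 1 x y \<noteq> 0 \<and> s 2 x y l \<noteq> 0 \<and>
      (x', y', l') = (q 2 x y / q 1 x y, q 3 x y / q 1 x y, s 3 x y l / s 2 x y l)"
    then have "q 2 x y = q 1 x y * x' \<and> q 3 x y = q 1 x y * y'" by auto
    moreover have "r 2 l = r 1 l * x' + s 2 x y l / q 1 x y"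
      "r 3 l = r 1 l * y' + s 2 x y l / q 1 x y * l'"
      using * by (auto simp: s_def field_simps)
    ultimately show "flag_aff B (x, y, l) = flag_aff A (x', y', l')"
      using eq q r by auto
  qed
qed

text \<open>Closures in the flag variety can be computed in a chart because of this. The topology is defined by preimages under all charts, so this rests on the
  continuity of the coordinate changes and on their domains being open.\<close>

lemma open_flag_aff_image:
  assumes A: "invertible A" and V: "open V"
  shows "open (flag_aff A ` V)"
  unfolding open_flag_def
proof
  fix \<phi> assume "\<phi> \<in> flag_atlas"
  then obtain B where B: "invertible B" "\<phi> = flag_aff B" by (auto simp: flag_atlas_def)
  obtain A' where "A ** A' = mat 1" using A unfolding invertible_def by blast
  then have BC: "B = A ** (A' ** B)" by (simp add: matrix_mul_assoc)
  define C where "C = A' ** B"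
  define q where "q i x y = C$i$1 + C$i$2 * x + C$i$3 * y" for i x y
  define r where "r i l = C$i$2 + C$i$3 * l" for i l
  define s where "s i x y l = q 1 x y * r i l - r 1 l * q i x y" for i x y l
  note tr = flag_aff_transition[OF A B(1) BC[folded C_def] q_def r_def s_def]
  define D where "D = {v :: complex \<times> complex \<times> complex.
    q 1 (fst v) (fst (snd v)) \<noteq> 0 \<and> s 2 (fst v) (fst (snd v)) (snd (snd v)) \<noteq> 0}"
  define \<tau> where "\<tau> = (\<lambda>v. (q 2 (fst v) (fst (snd v)) / q 1 (fst v) (fst (snd v)),
    q 3 (fst v) (fst (snd v)) / q 1 (fst v) (fst (snd v)),
    s 3 (fst v) (fst (snd v)) (snd (snd v)) / s 2 (fst v) (fst (snd v)) (snd (snd v))))"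
  have "open D"
    unfolding D_def s_def q_def r_def
    by (intro open_Collect_conj open_Collect_neq continuous_intros)
  moreover have "continuous_on D \<tau>"
    unfolding \<tau>_def s_def q_def r_def
    by (intro continuous_intros) (auto simp: D_def s_def q_def r_def)
  ultimately have "open (\<tau> -` V \<inter> D)"
    using V continuous_on_open_vimage[of D \<tau>] by blast
  moreover have "\<phi> -` (flag_aff A ` V) = \<tau> -` V \<inter> D"
  proof (rule set_eqI)
    fix v :: "complex \<times> complex \<times> complex"
    obtain x y l where v: "v = (x, y, l)" by (cases v) auto
    have "v \<in> \<phi> -` (flag_aff A ` V) \<longleftrightarrow> (\<exists>x' y' l'. (x', y', l') \<in> V \<and>
        flag_aff B (x, y, l) = flag_aff A (x', y', l'))"
      by (simp add: v B(2) image_iff Bex_def split_paired_Ex)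
    also have "\<dots> \<longleftrightarrow> v \<in> \<tau> -` V \<inter> D"
      unfolding tr by (auto simp: v D_def \<tau>_def)
    finally show "v \<in> \<phi> -` (flag_aff A ` V) \<longleftrightarrow> v \<in> \<tau> -` V \<inter> D" .
  qed
  ultimately show "open (\<phi> -` (flag_aff A ` V))" by simp
qed

definition swap_frame :: "complex ^ 3 ^ 3" where
  "swap_frame = vector [vector [1, 0, 0], vector [0, 0, 1], vector [0, 1, 0]]"

lemma swap_frame_mult: "swap_frame *v vector [a, b, c] = vector [a, c, b]"
  by (simp add: swap_frame_def matrix_vector_3)

lemma invertible_swap_frame: "invertible swap_frame"
proof -
  have "swap_frame ** swap_frame = mat 1"
    by (simp add: vec_eq_iff forall_3 matrix_matrix_mult_def sum_3 swap_frame_def mat_def)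
  then show ?thesis unfolding invertible_def by blast
qed

lemma aff_swap_frame: "aff (A ** swap_frame) (x, y) = aff A (y, x)"
  by (simp add: aff_def swap_frame_mult flip: matrix_vector_mul_assoc)

text \<open>The line contains a point at infinity \<open>(0, s, t)\<close> of the frame \<open>A\<close>. It has the slope \<open>t / s\<close> if
  \<open>s\<close> is nonzero, and otherwise it is vertical, that is of slope \<open>0\<close> after the exchange of \<open>x\<close> and \<open>y\<close>.\<close>

lemma flag_in_chart_or_swapped_chart:
  assumes A: "invertible A" and w: "pt w \<in> range (aff A)"
  shows "w \<in> range (flag_aff A) \<or> w \<in> range (flag_aff (A ** swap_frame))"
proof -
  obtain x y where z: "pt w = aff A (x, y)" using w by auto
  obtain H where H: "vec.subspace H" "vec.dim H = 2" and d: "ln_of w = projectivize H"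
    using Rep_flag[of w] by (auto simp: projective_line_def ln_of_def)
  have Rw: "Rep_flag w = (aff A (x, y), projectivize H)"
    using z d by (simp add: pt_def ln_of_def prod_eq_iff)
  have zH: "Rep_cp2 (aff A (x, y)) \<subseteq> H"
    using Rep_flag[of w] Rw d by (auto simp: projectivize_def)
  let ?a = "A *v vector [1, x, y]"
  have a: "vec.span {?a} \<subseteq> H" "?a \<in> H"
    using zH vec.span_base by (auto simp: Rep_aff A)
  have "\<not> H \<subseteq> vec.span {?a}"
  proof
    assume "H \<subseteq> vec.span {?a}"
    then have "vec.dim H \<le> vec.dim (vec.span {?a})" by (rule vec.dim_subset)
    then show False using H(2) by (simp add: vec.dim_span vec.dim_singleton split: if_splits)
  qed
  then obtain h where h: "h \<in> H" "h \<notin> vec.span {?a}" by blast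
  obtain A' where A': "A ** A' = mat 1" using A unfolding invertible_def by blast
  define k where "k = A' *v h"
  define s t where "s = k$2 - k$1 * x" and "t = k$3 - k$1 * y"
  have hk: "h = A *v k"
    by (simp add: k_def matrix_vector_mul_assoc A')
  have k: "k = k$1 *s vector [1, x, y] + vector [0, s, t]"
    by (simp add: vec_eq_iff forall_3 s_def t_def)
  have hst: "h = k$1 *s ?a + A *v vector [0, s, t]"
    unfolding hk by (subst k) (simp add: matrix_vector_right_distrib vector_scalar_commute)
  then have "A *v vector [0, s, t] = h - k$1 *s ?a" by simp
  then have stH: "A *v vector [0, s, t] \<in> H"
    using H(1) h(1) a(2) by (simp add: vec.subspace_diff vec.subspace_scale)
  have st: "s \<noteq> 0 \<or> t \<noteq> 0"
  proof (rule ccontr)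
    assume "\<not> ?thesis"
    then have "vector [0, s, t] = (0 :: complex ^ 3)" by (simp add: vec_eq_iff forall_3)
    then have "h = k$1 *s ?a" using hst by simp
    then show False using h(2) by (auto simp: vec.span_singleton)
  qed
  have line: "w = flag_aff B (x', y', l)"
    if B: "invertible B" and "aff B (x', y') = aff A (x, y)" and 1: "B *v vector [1, x', y'] \<in> H"
      and 2: "B *v vector [0, 1, l] \<in> H" for B x' y' l
  proof -
    have "vec.span {B *v vector [1, x', y'], B *v vector [0, 1, l]} = H"
      using 1 2 H slope_vectors_independent[OF B, of x' y' l]
      by (intro vec.subspace_dim_equal vec.span_minimal)
        (auto simp: vec.subspace_span vec.dim_span vec.dim_eq_card_independent)
    then have "Rep_flag w = Rep_flag (flag_aff B (x', y', l))"
      by (simp add: Rep_flag_aff[OF B] slope_line_def Rw that)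
    then show ?thesis by (simp add: Rep_flag_inject)
  qed
  show ?thesis
  proof (cases "s = 0")
    case False
    have "vector [0, 1, t / s] = (1 / s) *s (vector [0, s, t] :: complex ^ 3)"
      using False by (simp add: vec_eq_iff forall_3)
    then have "A *v vector [0, 1, t / s] = (1 / s) *s (A *v vector [0, s, t])"
      by (simp add: vector_scalar_commute)
    then have "A *v vector [0, 1, t / s] \<in> H" using H(1) stH by (simp add: vec.subspace_scale)
    then show ?thesis using line[OF A refl a(2)] by blast
  next
    case True
    have "vector [0, 0, 1] = (1 / t) *s (vector [0, s, t] :: complex ^ 3)"
      using True st by (simp add: vec_eq_iff forall_3)
    then have "A *v vector [0, 0, 1] = (1 / t) *s (A *v vector [0, s, t])"
      by (simp add: vector_scalar_commute)
    then have "A *v vector [0, 0, 1] \<in> H" using H(1) stH by (simp add: vec.subspace_scale)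
    then have "w = flag_aff (A ** swap_frame) (y, x, 0)"
      using a(2) by (intro line)
        (auto simp: invertible_mult A invertible_swap_frame aff_swap_frame swap_frame_mult
          simp flip: matrix_vector_mul_assoc)
    then show ?thesis by blast
  qed
qed

lemma closure_in_flag_chart:
  assumes A: "invertible A" and u: "flag_aff A u \<in> closure S"
  shows "u \<in> closure (flag_aff A -` S)"
proof (rule ccontr)
  let ?V = "- closure (flag_aff A -` S)"
  assume "u \<notin> closure (flag_aff A -` S)"
  then have "flag_aff A u \<in> flag_aff A ` ?V" by blast
  moreover have "flag_aff A ` ?V \<inter> S = {}"
    using closure_subset[of "flag_aff A -` S"] by auto
  moreover have "open (flag_aff A ` ?V)" by (rule open_flag_aff_image[OF A open_Compl[OF closed_closure]])
  ultimately show False using u open_Int_closure_eq_empty by blast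
qed

lemma tendsto_aff:
  assumes A: "invertible A" and f: "(f \<longlongrightarrow> a) F"
  shows "((\<lambda>n. aff A (f n)) \<longlongrightarrow> aff A a) F"
proof (rule topological_tendstoI)
  fix S assume S: "open S" "aff A a \<in> S"
  then have "open (aff A -` S)" using A by (auto simp: open_cp2_def cp2_atlas_def)
  then have "\<forall>\<^sub>F n in F. f n \<in> aff A -` S" using f S(2) topological_tendstoD by fastforce
  then show "\<forall>\<^sub>F n in F. aff A (f n) \<in> S" by simp
qed

section \<open>Transversality to a line\<close>

lemma tangent_id_UNIV: "tangent id UNIV x = UNIV"
proof -
  have "v \<in> tangent id UNIV x" for v
    unfolding tangent_def
    by (rule CollectI, rule exI[of _ "\<lambda>t. x + t *\<^sub>R v"]) (auto intro!: derivative_eq_intros)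
  then show ?thesis by blast
qed

text \<open>A vector lies in the direction of slope \<open>l\<close> iff its defect vanishes: \<open>defect l\<close> is the contact
  form \<open>dy - l dx\<close>, read in the plane.\<close>

definition defect :: "complex \<Rightarrow> complex \<times> complex \<Rightarrow> complex" where
  "defect l v = snd v - l * fst v"

lemma linear_defect: "linear (defect l)"
  by (rule linearI) (auto simp: defect_def algebra_simps)

lemma aff_in_slope_line_iff:
  assumes A: "invertible A"
  shows "aff A u \<in> slope_line A (x, y, l) \<longleftrightarrow> defect l (u - (x, y)) = 0"
proof -
  obtain x' y' where u: "u = (x', y')" by (cases u)
  let ?p = "A *v vector [1, x, y]" and ?q = "A *v vector [0, 1, l]" and ?r = "A *v vector [1, x', y']"
  have "aff A u \<in> slope_line A (x, y, l) \<longleftrightarrow> vec.span {?r} \<subseteq> vec.span {?p, ?q}"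
    by (simp add: u slope_line_def projectivize_def Rep_aff A)
  also have "\<dots> \<longleftrightarrow> ?r \<in> vec.span {?p, ?q}"
  proof
    assume "vec.span {?r} \<subseteq> vec.span {?p, ?q}"
    moreover have "?r \<in> vec.span {?r}" by (rule vec.span_base) simp
    ultimately show "?r \<in> vec.span {?p, ?q}" by blast
  next
    assume "?r \<in> vec.span {?p, ?q}"
    then show "vec.span {?r} \<subseteq> vec.span {?p, ?q}"
      by (intro vec.span_minimal vec.subspace_span) simp
  qed
  also have "\<dots> \<longleftrightarrow> (\<exists>k m. ?r = k *s ?p + m *s ?q)"
    by (rule vec_span_pair_iff)
  also have "\<dots> \<longleftrightarrow> (\<exists>k m. vector [1, x', y'] = k *s vector [1, x, y] + m *s (vector [0, 1, l] :: complex ^ 3))"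
    by (simp add: matrix_kernel[OF A] flip: vector_scalar_commute matrix_vector_right_distrib)
  also have "\<dots> \<longleftrightarrow> y' - y = l * (x' - x)"
  proof
    assume "\<exists>k m. vector [1, x', y'] = k *s vector [1, x, y] + m *s (vector [0, 1, l] :: complex ^ 3)"
    then obtain k m where "1 = k" "x' = k * x + m" "y' = k * y + m * l"
      by (auto simp: vec_eq_iff forall_3)
    then show "y' - y = l * (x' - x)" by (simp add: algebra_simps)
  next
    assume "y' - y = l * (x' - x)"
    then have "y' = y + (x' - x) * l" by (simp add: algebra_simps)
    then have "vector [1, x', y'] = 1 *s vector [1, x, y] + (x' - x) *s (vector [0, 1, l] :: complex ^ 3)"
      by (simp add: vec_eq_iff forall_3 algebra_simps)
    then show "\<exists>k m. vector [1, x', y'] = k *s vector [1, x, y] + m *s (vector [0, 1, l] :: complex ^ 3)"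
      by blast
  qed
  finally show ?thesis by (simp add: u defect_def)
qed

lemma tangent_line:
  assumes A: "invertible A"
  shows "tangent (aff A) (ln_of (flag_aff A (x, y, l))) (aff A (x, y)) = {v. defect l v = 0}"
proof -
  have ln: "ln_of (flag_aff A (x, y, l)) = slope_line A (x, y, l)"
    by (simp add: ln_of_def Rep_flag_aff A)
  have sub: "subspace {v. defect l v = 0}"
    using linear_defect by (rule linear_subspace_kernel)
  show ?thesis
    unfolding tangent_chart[OF inj_aff[OF A]] ln
  proof (intro set_eqI iffI)
    fix v assume "v \<in> tangent id (aff A -` slope_line A (x, y, l)) (x, y)"
    then obtain g where g: "(g has_vector_derivative v) (at (0::real))" "g 0 = (x, y)"
        "\<forall>\<^sub>F t in nhds 0. g t - (x, y) \<in> {v. defect l v = 0}"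
      by (auto simp: tangent_def aff_in_slope_line_iff A)
    have "((\<lambda>t. g t - (x, y)) has_vector_derivative v) (at 0)"
      using g(1) by (auto intro!: derivative_eq_intros)
    then show "v \<in> {v. defect l v = 0}"
      using vector_derivative_in_subspace[OF sub _ g(3)] by blast
  next
    fix v assume v: "v \<in> {v. defect l v = 0}"
    have "((\<lambda>t::real. (x, y) + t *\<^sub>R v) has_vector_derivative v) (at 0)"
      by (auto intro!: derivative_eq_intros)
    moreover have "defect l (t *\<^sub>R v) = 0" for t
      using v by (simp add: linear_scale[OF linear_defect])
    ultimately show "v \<in> tangent id (aff A -` slope_line A (x, y, l)) (x, y)"
      unfolding tangent_def
      by (intro CollectI exI[of _ "\<lambda>t. (x, y) + t *\<^sub>R v"])
        (auto simp: aff_in_slope_line_iff A simp del: scaleR_Pair)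
  qed
qed

lemma dp_flag_aff:
  assumes A: "invertible A"
  shows "dp A (flag_aff A u) v = (fst v, fst (snd v))"
proof -
  have "inv (aff A) \<circ> pt \<circ> flag_aff A = (\<lambda>u. (fst u, fst (snd u)))"
    using inj_aff[OF A] by (auto simp: pt_flag_aff A)
  moreover have "((\<lambda>u :: complex \<times> complex \<times> complex. (fst u, fst (snd u))) has_derivative
      (\<lambda>u. (fst u, fst (snd u)))) (at u)" for u
    by (intro derivative_intros)
  then have "frechet_derivative (\<lambda>u :: complex \<times> complex \<times> complex. (fst u, fst (snd u))) (at u) =
      (\<lambda>u. (fst u, fst (snd u)))" for u
    by (rule frechet_derivative_at[symmetric])
  ultimately show ?thesis
    by (simp add: dp_def tangent_map_def)
qed

lemma contact_flag_aff:
  assumes A: "invertible A"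
  shows "contact A (flag_aff A (x, y, l)) = {v. defect l (fst v, fst (snd v)) = 0}"
  by (simp add: contact_def tangent_chart[OF inj_flag_aff[OF A]] tangent_id_UNIV dp_flag_aff A
      pt_flag_aff tangent_line)

text \<open>The quotient of the plane by the direction of slope \<open>l\<close> is identified with \<open>\<complex>\<close> by \<open>defect l\<close>.\<close>

lemma spans_plane_iff_defect_onto:
  "{u + v | u v. u \<in> {u. defect l u = 0} \<and> v \<in> T} = UNIV \<longleftrightarrow> defect l ` T = UNIV"
proof
  assume *: "{u + v | u v. u \<in> {u. defect l u = 0} \<and> v \<in> T} = UNIV"
  have "c \<in> defect l ` T" for c
  proof -
    have "(0, c) \<in> {u + v | u v. u \<in> {u. defect l u = 0} \<and> v \<in> T}" using * by blast
    then obtain u v where uv: "(0, c) = u + v" "defect l u = 0" "v \<in> T" by blast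
    have "c = defect l (u + v)" by (simp add: defect_def flip: uv(1))
    then have "c = defect l v" using uv(2) by (simp add: linear_add[OF linear_defect])
    with uv(3) show ?thesis by blast
  qed
  then show "defect l ` T = UNIV" by blast
next
  assume *: "defect l ` T = UNIV"
  have "p \<in> {u + v | u v. u \<in> {u. defect l u = 0} \<and> v \<in> T}" for p
  proof -
    obtain v where v: "v \<in> T" "defect l p = defect l v" using * by (metis UNIV_I imageE)
    then have "defect l (p - v) = 0" by (simp add: linear_diff[OF linear_defect])
    moreover have "p = (p - v) + v" by simp
    ultimately show ?thesis using v(1) by blast
  qed
  then show "{u + v | u v. u \<in> {u. defect l u = 0} \<and> v \<in> T} = UNIV" by blast
qed

text \<open>A right inverse of \<open>f\<close> with values in \<open>T\<close> has a range that meets the kernel only in \<open>0\<close>.\<close>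

lemma dim_kernel_of_onto:
  fixes f :: "'a::euclidean_space \<Rightarrow> 'b::euclidean_space"
  assumes f: "linear f" and T: "subspace T" and onto: "f ` T = UNIV"
  shows "dim ({v. f v = 0} \<inter> T) + DIM('b) \<le> dim T"
proof -
  obtain g where g: "range g \<subseteq> T" "linear g" "\<And>v. f (g v) = v"
    using linear_exists_right_inverse_on[OF f T] onto by auto
  have K: "subspace ({v. f v = 0} \<inter> T)"
    by (intro subspace_inter linear_subspace_kernel f T)
  have R: "subspace (range g)" using g(2) by (simp add: linear_subspace_image)
  have "inj g" using g(3) by (metis injI)
  then have dg: "dim (range g) = DIM('b)"
    using dim_image_eq[OF g(2), of UNIV] by simp
  have "({v. f v = 0} \<inter> T) \<inter> range g \<subseteq> {0}" using g(3) linear_0[OF g(2)] by auto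
  then have "dim (({v. f v = 0} \<inter> T) \<inter> range g) = 0" by (metis dim_eq_0)
  then have "dim ({v. f v = 0} \<inter> T) + DIM('b) =
      dim {x + y | x y. x \<in> {v. f v = 0} \<inter> T \<and> y \<in> range g}"
    using dim_sums_Int[OF K R] dg by linarith
  also have "\<dots> \<le> dim T"
    using g(1) T by (intro dim_subset) (auto intro: subspace_add)
  finally show ?thesis .
qed

text \<open>Two vectors with real-linearly independent images suffice; \<open>r\<close> and \<open>s\<close> below come from Cramer's
  rule. Stated with a determinant, the criterion is visibly stable under perturbation.\<close>

lemma onto_complex_if_independent:
  fixes T :: "'a::real_vector set" and f :: "'a \<Rightarrow> complex"
  assumes f: "linear f" and T: "subspace T" and ab: "a \<in> T" "b \<in> T"
    and det: "Re (f a) * Im (f b) - Im (f a) * Re (f b) \<noteq> 0"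
  shows "f ` T = UNIV"
proof -
  let ?d = "Re (f a) * Im (f b) - Im (f a) * Re (f b)"
  have "c \<in> f ` T" for c
  proof -
    define r s where "r = (Re c * Im (f b) - Im c * Re (f b)) / ?d"
      and "s = (Re (f a) * Im c - Im (f a) * Re c) / ?d"
    have "f (r *\<^sub>R a + s *\<^sub>R b) = c"
      unfolding linear_add[OF f] linear_scale[OF f] r_def s_def using det
      by (simp add: complex_eq_iff divide_simps) (simp add: algebra_simps)
    moreover have "r *\<^sub>R a + s *\<^sub>R b \<in> T"
      using T ab by (simp add: subspace_add subspace_scale)
    ultimately show ?thesis by blast
  qed
  then show ?thesis by blast
qed

text \<open>Vectors of \<open>L\<close> with defects \<open>1\<close> and \<open>\<i>\<close> are approximated by vectors of \<open>T n\<close>, whose defects remain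
  independent.\<close>

lemma defect_onto_open:
  assumes l: "l \<longlonglongrightarrow> l'" and T: "\<And>n. subspace (T n)"
    and approx: "\<And>v. v \<in> L \<Longrightarrow> \<exists>Z. (\<forall>\<^sub>F n in sequentially. Z n \<in> T n) \<and> Z \<longlonglongrightarrow> v"
    and onto: "defect l' ` L = UNIV"
  shows "\<forall>\<^sub>F n in sequentially. defect (l n) ` T n = UNIV"
proof -
  obtain a b where ab: "a \<in> L" "defect l' a = 1" "b \<in> L" "defect l' b = \<i>"
    using onto by (metis UNIV_I imageE)
  obtain Y where Y: "\<forall>\<^sub>F n in sequentially. Y n \<in> T n" "Y \<longlonglongrightarrow> a" using approx ab(1) by blast
  obtain Z where Z: "\<forall>\<^sub>F n in sequentially. Z n \<in> T n" "Z \<longlonglongrightarrow> b" using approx ab(3) by blast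
  have lim: "(\<lambda>n. defect (l n) (X n)) \<longlonglongrightarrow> defect l' v" if "X \<longlonglongrightarrow> v" for X v
    unfolding defect_def by (intro tendsto_intros l that)
  let ?d = "\<lambda>n. Re (defect (l n) (Y n)) * Im (defect (l n) (Z n)) -
      Im (defect (l n) (Y n)) * Re (defect (l n) (Z n))"
  have "?d \<longlonglongrightarrow> Re (defect l' a) * Im (defect l' b) - Im (defect l' a) * Re (defect l' b)"
    by (intro tendsto_intros lim Y Z)
  then have "\<forall>\<^sub>F n in sequentially. ?d n \<noteq> 0"
    by (rule tendsto_imp_eventually_ne) (simp add: ab)
  with Y(1) Z(1) show ?thesis
    by eventually_elim (rule onto_complex_if_independent[OF linear_defect T])
qed

section \<open>The lift\<close>

text \<open>An image onto \<open>\<complex>\<close> would leave at most \<open>3 - 2 = 1\<close> dimension for the kernel of \<open>defect l \<circ> dp\<close> on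
  the tangent space of \<open>S\<close>, but this kernel is its intersection with the contact plane.\<close>

lemma semi_legendrian_tangent_projection:
  assumes A: "invertible A" and S: "submanifold flag_atlas (Suc k) 3 S"
    and leg: "semi_legendrian 3 S" and p: "p_submersion S N"
    and w: "flag_aff A (x, y, l) \<in> S"
  shows "subspace (tangent (aff A) N (aff A (x, y)))"
    and "defect l ` tangent (aff A) N (aff A (x, y)) \<noteq> UNIV"
proof -
  let ?T = "tangent (flag_aff A) S (flag_aff A (x, y, l))"
  let ?\<pi> = "\<lambda>v :: complex \<times> complex \<times> complex. (fst v, fst (snd v))"
  have \<pi>: "linear ?\<pi>" by (rule linearI) auto
  have atlas: "flag_aff A \<in> flag_atlas" using A by (auto simp: flag_atlas_def)
  have "subspace ?T \<and> dim ?T = 3"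
    using tangent_submanifold[of k 3 "flag_aff A -` S" "(x, y, l)"] S atlas w
    by (simp add: tangent_chart inj_flag_aff A submanifold_def)
  then have T: "subspace ?T" "dim ?T = 3" by auto
  have "dp A (flag_aff A (x, y, l)) ` ?T = tangent (aff A) N (pt (flag_aff A (x, y, l)))"
    using p A w unfolding p_submersion_def by blast
  then have img: "?\<pi> ` ?T = tangent (aff A) N (aff A (x, y))"
    by (simp add: dp_flag_aff[OF A] pt_flag_aff[OF A])
  show "subspace (tangent (aff A) N (aff A (x, y)))"
    unfolding img[symmetric] by (rule linear_subspace_image[OF \<pi> T(1)])
  have "euclidean_submanifold (Suc 0) 3 (\<phi> -` S)" if "\<phi> \<in> flag_atlas" for \<phi>
  proof -
    have "euclidean_submanifold (Suc k) 3 (\<phi> -` S)" using S that by (simp add: submanifold_def)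
    then show ?thesis unfolding euclidean_submanifold_def using Ck_on_Suc_imp_C1 by meson
  qed
  then have "flag_aff A (x, y, l) \<in> smooth_points flag_atlas 1 3 S"
    using w by (auto simp: smooth_points_def submanifold_def intro!: exI[of _ UNIV])
  then have contact: "dim (contact A (flag_aff A (x, y, l)) \<inter> ?T) \<ge> 2"
    using leg A unfolding semi_legendrian_def by blast
  show "defect l ` tangent (aff A) N (aff A (x, y)) \<noteq> UNIV"
  proof
    assume "defect l ` tangent (aff A) N (aff A (x, y)) = UNIV"
    then have "(defect l \<circ> ?\<pi>) ` ?T = UNIV" by (simp add: image_comp flip: img)
    then have "dim ({v. (defect l \<circ> ?\<pi>) v = 0} \<inter> ?T) + DIM(complex) \<le> dim ?T"
      using \<pi> T(1) linear_defect by (intro dim_kernel_of_onto linear_compose)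
    with contact show False by (simp add: T(2) contact_flag_aff[OF A])
  qed
qed

lemma tangent_aff_swap_frame:
  assumes A: "invertible A"
  shows "tangent (aff A) S z = prod.swap ` tangent (aff (A ** swap_frame)) S z"
proof -
  have 1: "aff A u = aff (A ** swap_frame) (prod.swap u)" for u
    by (cases u) (simp add: aff_swap_frame)
  have der: "((\<lambda>t. prod.swap (g t)) has_vector_derivative prod.swap v) (at 0)"
    if "(g has_vector_derivative v) (at 0)" for g :: "real \<Rightarrow> complex \<times> complex" and v
    using bounded_linear.has_vector_derivative[OF bounded_linear_Pair[OF bounded_linear_snd bounded_linear_fst] that]
    by (simp add: prod.swap_def)
  have "prod.swap v \<in> tangent (aff (A ** swap_frame)) S z \<longleftrightarrow> v \<in> tangent (aff A) S z" for v
  proof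
    assume "v \<in> tangent (aff A) S z"
    then obtain g where "(g has_vector_derivative v) (at (0::real))" "aff A (g 0) = z"
        "\<forall>\<^sub>F t in nhds 0. aff A (g t) \<in> S" by (auto simp: tangent_def)
    then show "prod.swap v \<in> tangent (aff (A ** swap_frame)) S z"
      unfolding tangent_def
      by (intro CollectI exI[of _ "\<lambda>t. prod.swap (g t)"]) (simp add: der flip: 1)
  next
    assume "prod.swap v \<in> tangent (aff (A ** swap_frame)) S z"
    then obtain g where "(g has_vector_derivative prod.swap v) (at (0::real))"
        "aff (A ** swap_frame) (g 0) = z"
        "\<forall>\<^sub>F t in nhds 0. aff (A ** swap_frame) (g t) \<in> S" by (auto simp: tangent_def)
    then show "v \<in> tangent (aff A) S z"
      unfolding tangent_def
      by (intro CollectI exI[of _ "\<lambda>t. prod.swap (g t)"]) (use der in \<open>fastforce simp: 1\<close>)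
  qed
  then have *: "u \<in> tangent (aff (A ** swap_frame)) S z \<longleftrightarrow> prod.swap u \<in> tangent (aff A) S z" for u
    by (metis swap_swap)
  show ?thesis
  proof (intro set_eqI iffI)
    fix v assume "v \<in> tangent (aff A) S z"
    then show "v \<in> prod.swap ` tangent (aff (A ** swap_frame)) S z"
      by (intro image_eqI[of _ _ "prod.swap v"]) (simp_all add: *)
  qed (auto simp: *)
qed

text \<open>The definition of the lift quantifies over all affine charts around the point \<open>p(w)\<close>, including
  those in which the line of \<open>w\<close> is vertical. It is enough to consider the charts in which the line has a
  slope, because a chart of the other kind becomes one of these by exchanging its coordinates.\<close>

lemma liftI:
  assumes N: "pt w \<in> N"
    and flag: "\<And>A x y l. invertible A \<Longrightarrow> w = flag_aff A (x, y, l) \<Longrightarrow>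
      defect l ` tangent (aff A) N (aff A (x, y)) \<noteq> UNIV"
  shows "w \<in> lift N"
proof -
  have near: "{u + v | u v. u \<in> tangent (aff A) (ln_of w) (pt w) \<and> v \<in> tangent (aff A) N (pt w)} \<noteq> UNIV"
    if A: "invertible A" and w: "w \<in> range (flag_aff A)" for A
  proof -
    obtain x y l where w: "w = flag_aff A (x, y, l)" using w by auto
    show ?thesis
      using flag[OF A w] by (simp only: w tangent_line[OF A] pt_flag_aff[OF A] spans_plane_iff_defect_onto) simp
  qed
  have "{u + v | u v. u \<in> tangent (aff A) (ln_of w) (pt w) \<and> v \<in> tangent (aff A) N (pt w)}
      \<noteq> tangent (aff A) UNIV (pt w)"
    if A: "invertible A" and z: "pt w \<in> range (aff A)" for A
  proof -
    have U: "tangent (aff A) UNIV (pt w) = UNIV"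
      using z by (auto simp: tangent_chart[OF inj_aff[OF A]] tangent_id_UNIV)
    show ?thesis
    proof (cases "w \<in> range (flag_aff A)")
      case True
      then show ?thesis using near[OF A] U by simp
    next
      case False
      \<comment> \<open>the line is vertical in the frame \<open>A\<close>; a vector missed in the exchanged frame is
        exchanged to one missed in \<open>A\<close>\<close>
      let ?A = "A ** swap_frame"
      let ?R = "{u + v | u v. u \<in> tangent (aff ?A) (ln_of w) (pt w) \<and> v \<in> tangent (aff ?A) N (pt w)}"
      have "w \<in> range (flag_aff ?A)" using flag_in_chart_or_swapped_chart[OF A z] False by blast
      then have "?R \<noteq> UNIV"
        using near[of ?A] by (simp add: invertible_mult A invertible_swap_frame)
      then obtain c where c: "c \<notin> ?R" by blast
      have "prod.swap c \<notin> {u + v | u v. u \<in> tangent (aff A) (ln_of w) (pt w) \<and> v \<in> tangent (aff A) N (pt w)}"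
      proof
        assume "prod.swap c \<in> {u + v | u v. u \<in> tangent (aff A) (ln_of w) (pt w) \<and> v \<in> tangent (aff A) N (pt w)}"
        then obtain u v where uv: "prod.swap c = prod.swap u + prod.swap v"
            "u \<in> tangent (aff ?A) (ln_of w) (pt w)" "v \<in> tangent (aff ?A) N (pt w)"
          unfolding tangent_aff_swap_frame[OF A] by blast
        then have "c = u + v" by (auto simp: prod_eq_iff)
        with uv c show False by blast
      qed
      then show ?thesis using U by blast
    qed
  qed
  then show ?thesis using N by (auto simp: lift_def)
qed

theorem mainTheorem2:
  fixes M :: "flag set"
    and I :: "'i set" and Ms :: "'i \<Rightarrow> flag set" and dM :: "'i \<Rightarrow> nat"
    and J :: "'j set" and Ns :: "'j \<Rightarrow> cp2 set" and dN :: "'j \<Rightarrow> nat"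
  assumes "singular_submanifold_dim flag_atlas 2 3 M"
    and "singular_submanifold cp2_atlas 1 (pt ` M)"
    and "stratification flag_atlas 2 I Ms dM M"
    and "stratification cp2_atlas 1 J Ns dN (pt ` M)"
    and "\<And>i. i \<in> I \<Longrightarrow> dM i = 3 \<Longrightarrow> semi_legendrian 3 (Ms i)"
    and "\<And>i j. i \<in> J \<Longrightarrow> j \<in> J \<Longrightarrow> stratum_less Ns i j \<Longrightarrow>
           tangent_spaces_converge (Ns i) (Ns j)"
    and "\<And>i. i \<in> I \<Longrightarrow> \<exists>j\<in>J. p_submersion (Ms i) (Ns j)"
  shows "M \<subseteq> (\<Union>j\<in>J. lift (Ns j))"
proof
  fix w assume w: "w \<in> M"
  obtain i where i: "i \<in> I" "w \<in> Ms i" using w assms(3) by (auto simp: stratification_def)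
  obtain j where j: "j \<in> J" "p_submersion (Ms i) (Ns j)" using assms(7) i(1) by blast
  have ptw: "pt w \<in> Ns j" using j(2) i(2) by (auto simp: p_submersion_def)
  have two: "2 = Suc 1" by simp
  obtain h where h: "h \<in> I" "dM h = 3" "w \<in> closure (Ms h)"
  proof -
    have cover: "\<exists>\<phi>\<in>flag_atlas. z \<in> range \<phi>" for z
      using flag_aff_covers[of z] by (auto simp: flag_atlas_def)
    have cont: "open (\<phi> -` U)" if "\<phi> \<in> flag_atlas" "open U" for \<phi> U
      using that by (simp add: open_flag_def)
    show ?thesis
      using that maximal_stratum_dense[OF cover cont assms(1,3)[unfolded two] w] by blast
  qed
  have subM: "submanifold flag_atlas (Suc 1) 3 (Ms h)"
    using assms(3) h(1,2) unfolding two stratification_def by metis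
  have leg: "semi_legendrian 3 (Ms h)" using assms(5) h(1,2) .
  obtain k where k: "k \<in> J" "p_submersion (Ms h) (Ns k)" using assms(7) h(1) by blast
  have "w \<in> lift (Ns j)"
  proof (rule liftI[OF ptw])
    fix A x y l assume A: "invertible A" and wA: "w = flag_aff A (x, y, l)"
    have "(x, y, l) \<in> closure (flag_aff A -` Ms h)"
      using closure_in_flag_chart[OF A] h(3) wA by blast
    then obtain u where u: "\<And>n. u n \<in> flag_aff A -` Ms h" "u \<longlonglongrightarrow> (x, y, l)"
      unfolding closure_sequential by blast
    define X where "X n = (fst (u n), fst (snd (u n)))" for n
    define s where "s n = snd (snd (u n))" for n
    have un: "flag_aff A (fst (X n), snd (X n), s n) \<in> Ms h" for n
      using u(1)[of n] by (simp add: X_def s_def)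
    have X: "X \<longlonglongrightarrow> (x, y)" and s: "s \<longlonglongrightarrow> l"
      using tendsto_fst[OF u(2)] tendsto_snd[OF u(2)] tendsto_fst[OF tendsto_snd[OF u(2)]]
        tendsto_snd[OF tendsto_snd[OF u(2)]]
      by (auto simp: X_def[abs_def] s_def[abs_def] intro!: tendsto_Pair)
    have XN: "aff A (X n) \<in> Ns k" for n
      using k(2) un[of n] pt_flag_aff[OF A] unfolding p_submersion_def
      by (metis image_subset_iff prod.collapse)
    have lim: "(\<lambda>n. aff A (X n)) \<longlonglongrightarrow> aff A (x, y)" by (rule tendsto_aff[OF A X])
    let ?T = "\<lambda>n. tangent (aff A) (Ns k) (aff A (X n))"
    have T: "subspace (?T n)" "defect (s n) ` ?T n \<noteq> UNIV" for n
      using semi_legendrian_tangent_projection[OF A subM leg k(2) un[of n]] by auto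
    have z: "aff A (x, y) \<in> Ns j" using ptw by (simp add: wA pt_flag_aff A)
    have approx: "\<exists>Z. (\<forall>\<^sub>F n in sequentially. Z n \<in> ?T n) \<and> Z \<longlonglongrightarrow> v"
      if v: "v \<in> tangent (aff A) (Ns j) (aff A (x, y))" for v
    proof (cases "j = k")
      case True
      have "submanifold cp2_atlas (Suc 0) (dN k) (Ns k)"
        using assms(4) k(1) by (auto simp: stratification_def)
      then have "euclidean_submanifold (Suc 0) (dN k) (aff A -` Ns k)"
        using A by (auto simp: submanifold_def cp2_atlas_def)
      from tangent_lower_semicontinuous[OF this _ _ X, of v] show ?thesis
        using v z XN True by (simp add: tangent_chart[OF inj_aff[OF A]])
    next
      case False
      have "aff A (x, y) \<in> closure (Ns k)"
        using lim XN closure_subset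
        by (intro Lim_in_closed_set[OF closed_closure _ _ lim]) (auto intro!: always_eventually)
      then have "stratum_less Ns j k" using z False by (auto simp: stratum_less_def)
      then have conv: "tangent_spaces_converge (Ns j) (Ns k)" using assms(6) j(1) k(1) by blast
      have "\<exists>L. subspaces_tendsto ?T L \<and> tangent (aff A) (Ns j) (aff A (x, y)) \<subseteq> L"
        using conv[unfolded tangent_spaces_converge_def, rule_format,
          of "\<lambda>n. aff A (X n)" "aff A (x, y)" A] XN z lim A by blast
      then obtain L where L: "subspaces_tendsto ?T L" "tangent (aff A) (Ns j) (aff A (x, y)) \<subseteq> L"
        by blast
      show ?thesis using subspaces_tendsto_approx[OF L(1) T(1)] L(2) v by blast
    qed
    show "defect l ` tangent (aff A) (Ns j) (aff A (x, y)) \<noteq> UNIV"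
    proof
      assume "defect l ` tangent (aff A) (Ns j) (aff A (x, y)) = UNIV"
      then have "\<forall>\<^sub>F n in sequentially. defect (s n) ` ?T n = UNIV"
        using defect_onto_open[OF s T(1) approx] by blast
      then show False using T(2) by simp
    qed
  qed
  with j(1) show "w \<in> (\<Union>j\<in>J. lift (Ns j))" by blast
qed

end
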